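(* Let $\Lambda$ be a row-finite $k$-graph with no sources such that $\Lambda^0$ is a maximal tail. (1) The set $\operatorname{Per}(\Lambda)$ is a subgroup of $\mathbb{Z}^k$. (2) The set $H_{\operatorname{Per}}$ is a nonempty hereditary subset of $\Lambda^0$, and for all $p,q\in\mathbb{N}^k$ such that $p-q\in\operatorname{Per}(\Lambda)$ and all $x\in H_{\operatorname{Per}}\Lambda^\infty$, we have $\sigma^p(x)=\sigma^q(x)$. (3) If $\lambda\in\Lambda$ and $m\in\mathbb{N}^k$ satisfy $r(\lambda)\in H_{\operatorname{Per}}$ and $d(\lambda)-m\in\operatorname{Per}(\Lambda)$, then there is a unique $\mu\in r(\lambda)\Lambda^m$ such that $\mu\sim\lambda$; in particular, if $\lambda\sim\mu$ and $d(\lambda)=d(\mu)$, then $\lambda=\mu$. (4) If $q_{\operatorname{Per}}:\mathbb{Z}^k\to\mathbb{Z}^k/\operatorname{Per}(\Lambda)$ is the quotient map, then the set $\Gamma:=(H_{\operatorname{Per}}\Lambda)/\!\sim$ is a $q_{\operatorname{Per}}(\mathbb{N}^k)$-graph with degree map $\widetilde d:=q_{\operatorname{Per}}\circ d$ (that is, $\widetilde d([\lambda])=q_{\operatorname{Per}}(d(\lambda))$). (5) The assignment $\lambda\mapsto([\lambda],d(\lambda))$ is an isomorphism of $H_{\operatorname{Per}}\Lambda$ onto the pullback $q_{\operatorname{Per}}^*\Gamma$.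
   Context: Conventions: $\mathbb{N}$ contains $0$. For a finitely generated cancellative abelian monoid $P$ (regarded as a category with one object), a $P$-graph is a countable small category $\Gamma$ (identified with its set of morphisms) with a functor $d:\Gamma\to P$ satisfying the factorisation property: whenever $d(\xi)=p+q$ there exist unique $\eta,\zeta\in\Gamma$ with $d(\eta)=p$, $d(\zeta)=q$ and $\xi=\eta\zeta$. A $k$-graph is an $\mathbb{N}^k$-graph. Write $\Gamma^p=d^{-1}(p)$; $r,s$ denote codomain and domain. $\Gamma^0$ is the set of identity morphisms, identified with the objects. For $v,w\in\Lambda^0$: $v\Lambda=\{\lambda:r(\lambda)=v\}$, $v\Lambda^n=v\Lambda\cap\Lambda^n$, $v\Lambda w=\{\lambda: r(\lambda)=v,s(\lambda)=w\}$; for $H\subseteq\Lambda^0$, $H\Lambda=\{\lambda:r(\lambda)\in H\}$. A $k$-graph $\Lambda$ is row-finite with no sources if $0<|v\Lambda^n|<\infty$ for all $v\in\Lambda^0$, $n\in\mathbb{N}^k$. A set $H\subseteq\Lambda^0$ is hereditary if $s(H\Lambda)\subseteq H$. A morphism of $P$-graphs is a degree-preserving functor. $\Lambda^0$ is a maximal tail if it is nonempty and: (a) for all $v_1,v_2\in\Lambda^0$ there is $w\in\Lambda^0$ with $v_1\Lambda w\ne\emptyset\ne v_2\Lambda w$; (b) for all $v\in\Lambda^0$, $1\le i\le k$ there is $\lambda\in v\Lambda^{e_i}$; (c) if $v\Lambda w\neq\emptyset$ with $w\in\Lambda^0$ then $v\in\Lambda^0$ ((b), (c) being automatic here). Infinite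 paths: $\Omega_k=\{(m,n)\in\mathbb{N}^k\times\mathbb{N}^k:m\le n\}$ is a $k$-graph with $r(m,n)=m$, $s(m,n)=n$, $(m,n)(n,p)=(m,p)$, $d(m,n)=n-m$. $\Lambda^\infty$ is the set of degree-preserving functors $x:\Omega_k\to\Lambda$; $r(x)=x(0):=x(0,0)$, $\sigma^p(x)(m,n)=x(m+p,n+p)$, and for $\lambda\in\Lambda$ with $s(\lambda)=x(0)$, $\lambda x$ is the unique infinite path with $(\lambda x)(0,d(\lambda))=\lambda$ and $\sigma^{d(\lambda)}(\lambda x)=x$. Write $v\Lambda^\infty=\{x:x(0)=v\}$ and $H\Lambda^\infty=\{x:x(0)\in H\}$. The relation $\sim$ on $\Lambda$: $\mu\sim\nu$ iff $s(\mu)=s(\nu)$ and $\mu x=\nu x$ for all $x\in s(\mu)\Lambda^\infty$. This is an equivalence relation respecting range, source and composition, so $\Lambda/\!\sim$ is a category with $r([\lambda])=[r(\lambda)]$, $s([\lambda])=[s(\lambda)]$, $[\lambda][\mu]=[\lambda\mu]$; $(H_{\operatorname{Per}}\Lambda)/\!\sim$ carries the same structure. Define $$\operatorname{Per}(\Lambda)=\{d(\mu)-d(\nu):\mu,\nu\in\Lambda,\ \mu\sim\nu\}\subseteq\mathbb{Z}^k,$$ and let $H_{\operatorname{Per}}$ be the set of $v\in\Lambda^0$ such that for all $\lambda\in v\Lambda$ and $m\in\mathbb{N}^k$ with $d(\lambda)-m\in\operatorname{Per}(\Lambda)$ there exists $\mu\in v\Lambda^m$ with $\lambda\sim\mu$.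 Pullback: for the homomorphism $q=q_{\operatorname{Per}}:\mathbb{N}^k\to P:=q(\mathbb{N}^k)$ and a $P$-graph $(\Gamma,\widetilde d)$, $q^*\Gamma=\{(\xi,n)\in\Gamma\times\mathbb{N}^k:\widetilde d(\xi)=q(n)\}$ with $d(\xi,n)=n$, $s(\xi,n)=(s(\xi),0)$, $r(\xi,n)=(r(\xi),0)$, and $(\mu,m)(\nu,n)=(\mu\nu,m+n)$; it is a $k$-graph. *)

theory Defs
  imports "HOL-Analysis.Finite_Cartesian_Product" "HOL-Algebra.Coset"
    "HOL-Library.Countable_Set" "HOL-Library.FuncSet"
begin

section \<open>Small categories and P-graphs\<close>

text \<open>
  A small category is given by its set of morphisms. An object is identified with its identity
  morphism, so codomain and domain (\<open>rng\<close>, \<open>src\<close>) take values in the morphisms.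
  The product \<open>cmp C f g\<close> means ``f after g'' and is meaningful only if \<open>src C f = rng C g\<close>.
\<close>

record 'a cat =
  arr :: "'a set"
  rng :: "'a \<Rightarrow> 'a"
  src :: "'a \<Rightarrow> 'a"
  cmp :: "'a \<Rightarrow> 'a \<Rightarrow> 'a"

definition objs :: "('a, 'm) cat_scheme \<Rightarrow> 'a set" where
  "objs C = {v \<in> arr C. rng C v = v \<and> src C v = v}"

locale small_category =
  fixes C :: "('a, 'm) cat_scheme"
  assumes rng_objs: "f \<in> arr C \<Longrightarrow> rng C f \<in> objs C"
    and src_objs: "f \<in> arr C \<Longrightarrow> src C f \<in> objs C"
    and cmp_closed: "\<lbrakk>f \<in> arr C; g \<in> arr C; src C f = rng C g\<rbrakk> \<Longrightarrow> cmp C f g \<in> arr C"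
    and rng_cmp: "\<lbrakk>f \<in> arr C; g \<in> arr C; src C f = rng C g\<rbrakk> \<Longrightarrow> rng C (cmp C f g) = rng C f"
    and src_cmp: "\<lbrakk>f \<in> arr C; g \<in> arr C; src C f = rng C g\<rbrakk> \<Longrightarrow> src C (cmp C f g) = src C g"
    and id_left: "f \<in> arr C \<Longrightarrow> cmp C (rng C f) f = f"
    and id_right: "f \<in> arr C \<Longrightarrow> cmp C f (src C f) = f"
    and cmp_assoc: "\<lbrakk>f \<in> arr C; g \<in> arr C; h \<in> arr C; src C f = rng C g; src C g = rng C h\<rbrakk>
      \<Longrightarrow> cmp C (cmp C f g) h = cmp C f (cmp C g h)"

record ('a, 'p) pgraph = "'a cat" +
  deg :: "'a \<Rightarrow> 'p"

definition finitely_generated_monoid :: "('p, 'b) monoid_scheme \<Rightarrow> bool" where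
  "finitely_generated_monoid P \<longleftrightarrow>
     (\<exists>S. finite S \<and> S \<subseteq> carrier P \<and> (\<forall>H. submonoid H P \<and> S \<subseteq> H \<longrightarrow> H = carrier P))"

locale fg_cancellative_comm_monoid = comm_monoid P
  for P :: "('p, 'b) monoid_scheme" (structure) +
  assumes cancel: "\<lbrakk>p \<in> carrier P; q \<in> carrier P; t \<in> carrier P; p \<otimes> t = q \<otimes> t\<rbrakk> \<Longrightarrow> p = q"
    and finitely_generated: "finitely_generated_monoid P"

locale P_graph = fg_cancellative_comm_monoid P + small_category \<Gamma>
  for P :: "('p, 'b) monoid_scheme" (structure) and \<Gamma> :: "('a, 'p) pgraph" +
  assumes countable_arr: "countable (arr \<Gamma>)"
    and deg_closed: "\<xi> \<in> arr \<Gamma> \<Longrightarrow> deg \<Gamma> \<xi> \<in> carrier P"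
    and deg_objs: "v \<in> objs \<Gamma> \<Longrightarrow> deg \<Gamma> v = \<one>"
    and deg_cmp: "\<lbrakk>\<eta> \<in> arr \<Gamma>; \<zeta> \<in> arr \<Gamma>; src \<Gamma> \<eta> = rng \<Gamma> \<zeta>\<rbrakk>
      \<Longrightarrow> deg \<Gamma> (cmp \<Gamma> \<eta> \<zeta>) = deg \<Gamma> \<eta> \<otimes> deg \<Gamma> \<zeta>"
    and factorisation: "\<lbrakk>\<xi> \<in> arr \<Gamma>; p \<in> carrier P; q \<in> carrier P; deg \<Gamma> \<xi> = p \<otimes> q\<rbrakk>
      \<Longrightarrow> \<exists>!(\<eta>, \<zeta>). \<eta> \<in> arr \<Gamma> \<and> \<zeta> \<in> arr \<Gamma> \<and> src \<Gamma> \<eta> = rng \<Gamma> \<zeta>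
            \<and> deg \<Gamma> \<eta> = p \<and> deg \<Gamma> \<zeta> = q \<and> \<xi> = cmp \<Gamma> \<eta> \<zeta>"

text \<open>A morphism of P-graphs is a degree-preserving functor.\<close>

definition degree_functor :: "('a, 'p) pgraph \<Rightarrow> ('b, 'p) pgraph \<Rightarrow> ('a \<Rightarrow> 'b) \<Rightarrow> bool" where
  "degree_functor \<Gamma> \<Delta> f \<longleftrightarrow>
     (\<forall>\<xi>\<in>arr \<Gamma>. f \<xi> \<in> arr \<Delta> \<and> rng \<Delta> (f \<xi>) = f (rng \<Gamma> \<xi>) \<and> src \<Delta> (f \<xi>) = f (src \<Gamma> \<xi>)
        \<and> deg \<Delta> (f \<xi>) = deg \<Gamma> \<xi>) \<and>
     (\<forall>\<eta>\<in>arr \<Gamma>. \<forall>\<zeta>\<in>arr \<Gamma>. src \<Gamma> \<eta> = rng \<Gamma> \<zeta> \<longrightarrow> f (cmp \<Gamma> \<eta> \<zeta>) = cmp \<Delta> (f \<eta>) (f \<zeta>))"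

definition P_graph_iso ::
    "('p, 'c) monoid_scheme \<Rightarrow> ('a, 'p) pgraph \<Rightarrow> ('b, 'p) pgraph \<Rightarrow> ('a \<Rightarrow> 'b) \<Rightarrow> bool" where
  "P_graph_iso P \<Gamma> \<Delta> f \<longleftrightarrow> P_graph P \<Gamma> \<and> P_graph P \<Delta> \<and> degree_functor \<Gamma> \<Delta> f \<and>
     (\<exists>g. degree_functor \<Delta> \<Gamma> g \<and> (\<forall>\<xi>\<in>arr \<Gamma>. g (f \<xi>) = \<xi>) \<and> (\<forall>\<eta>\<in>arr \<Delta>. f (g \<eta>) = \<eta>))"

definition restrict_range :: "('a, 'p) pgraph \<Rightarrow> 'a set \<Rightarrow> ('a, 'p) pgraph" where
  "restrict_range \<Lambda> H = \<Lambda>\<lparr>arr := {l \<in> arr \<Lambda>. rng \<Lambda> l \<in> H}\<rparr>"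

definition pullback :: "('n::comm_monoid_add \<Rightarrow> 'p) \<Rightarrow> ('a, 'p) pgraph \<Rightarrow> ('a \<times> 'n, 'n) pgraph" where
  "pullback f \<Gamma> =
     \<lparr>arr = {(\<xi>, n). \<xi> \<in> arr \<Gamma> \<and> deg \<Gamma> \<xi> = f n},
      rng = (\<lambda>(\<xi>, n). (rng \<Gamma> \<xi>, 0)),
      src = (\<lambda>(\<xi>, n). (src \<Gamma> \<xi>, 0)),
      cmp = (\<lambda>(\<mu>, m) (\<nu>, n). (cmp \<Gamma> \<mu> \<nu>, m + n)),
      deg = snd\<rparr>"

section \<open>k-graphs\<close>

text \<open>\<open>plus_monoid :: (nat^'k) monoid\<close> is N^k and \<open>plus_monoid :: (int^'k) monoid\<close> is Z^k.\<close>

definition plus_monoid :: "'n::comm_monoid_add monoid" where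
  "plus_monoid = \<lparr>carrier = UNIV, monoid.mult = (+), one = 0\<rparr>"

abbreviation k_graph :: "('a, nat^'k::finite) pgraph \<Rightarrow> bool" where
  "k_graph \<equiv> P_graph plus_monoid"

definition int_vec :: "nat^'k::finite \<Rightarrow> int^'k" where
  "int_vec n = (\<chi> i. int (n $ i))"

definition paths_of_degree :: "('a, 'p) pgraph \<Rightarrow> 'a \<Rightarrow> 'p \<Rightarrow> 'a set" where
  "paths_of_degree \<Lambda> v n = {l \<in> arr \<Lambda>. rng \<Lambda> l = v \<and> deg \<Lambda> l = n}"

definition paths_between :: "('a, 'p) pgraph \<Rightarrow> 'a \<Rightarrow> 'a \<Rightarrow> 'a set" where
  "paths_between \<Lambda> v w = {l \<in> arr \<Lambda>. rng \<Lambda> l = v \<and> src \<Lambda> l = w}"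

definition row_finite_no_sources :: "('a, nat^'k::finite) pgraph \<Rightarrow> bool" where
  "row_finite_no_sources \<Lambda> \<longleftrightarrow>
     (\<forall>v\<in>objs \<Lambda>. \<forall>n. paths_of_degree \<Lambda> v n \<noteq> {} \<and> finite (paths_of_degree \<Lambda> v n))"

definition hereditary :: "('a, 'p) pgraph \<Rightarrow> 'a set \<Rightarrow> bool" where
  "hereditary \<Lambda> H \<longleftrightarrow> H \<subseteq> objs \<Lambda> \<and> src \<Lambda> ` {l \<in> arr \<Lambda>. rng \<Lambda> l \<in> H} \<subseteq> H"

definition maximal_tail :: "('a, nat^'k::finite) pgraph \<Rightarrow> 'a set \<Rightarrow> bool" where
  "maximal_tail \<Lambda> T \<longleftrightarrow> T \<subseteq> objs \<Lambda> \<and> T \<noteq> {} \<and>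
     (\<forall>v1\<in>T. \<forall>v2\<in>T. \<exists>w\<in>T. paths_between \<Lambda> v1 w \<noteq> {} \<and> paths_between \<Lambda> v2 w \<noteq> {}) \<and>
     (\<forall>v\<in>T. \<forall>i. \<exists>l\<in>paths_of_degree \<Lambda> v (axis i 1). src \<Lambda> l \<in> T) \<and>
     (\<forall>v\<in>objs \<Lambda>. \<forall>w\<in>T. paths_between \<Lambda> v w \<noteq> {} \<longrightarrow> v \<in> T)"

section \<open>Infinite paths and periodicity\<close>

text \<open>As objects are identities, the object \<open>m\<close> of \<open>\<Omega>\<^sub>k\<close> is the pair \<open>(m, m)\<close>.\<close>

definition Omega :: "((nat^'k::finite) \<times> (nat^'k), nat^'k) pgraph" where
  "Omega =
     \<lparr>arr = {(m, n). m \<le> n},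
      rng = (\<lambda>(m, n). (m, m)),
      src = (\<lambda>(m, n). (n, n)),
      cmp = (\<lambda>(m, n) (n', p). (m, p)),
      deg = (\<lambda>(m, n). n - m)\<rparr>"

type_synonym ('a, 'k) inf_path = "(nat^'k) \<times> (nat^'k) \<Rightarrow> 'a"

text \<open>
  Extensionality makes equality of infinite paths equality of functions on \<open>\<Omega>\<^sub>k\<close>. The shift
  preserves it, because \<open>m + p \<le> n + p\<close> iff \<open>m \<le> n\<close>.
\<close>

definition inf_paths :: "('a, nat^'k::finite) pgraph \<Rightarrow> ('a, 'k) inf_path set" where
  "inf_paths \<Lambda> = {x \<in> extensional (arr Omega). degree_functor Omega \<Lambda> x}"

definition inf_paths_from :: "('a, nat^'k::finite) pgraph \<Rightarrow> 'a set \<Rightarrow> ('a, 'k) inf_path set" where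
  "inf_paths_from \<Lambda> H = {x \<in> inf_paths \<Lambda>. x (0, 0) \<in> H}"

definition shift :: "nat^'k::finite \<Rightarrow> ('a, 'k) inf_path \<Rightarrow> ('a, 'k) inf_path" where
  "shift p x = (\<lambda>(m, n). x (m + p, n + p))"

definition prepend ::
    "('a, nat^'k::finite) pgraph \<Rightarrow> 'a \<Rightarrow> ('a, 'k) inf_path \<Rightarrow> ('a, 'k) inf_path" where
  "prepend \<Lambda> l x = (THE y. y \<in> inf_paths \<Lambda> \<and> y (0, deg \<Lambda> l) = l \<and> shift (deg \<Lambda> l) y = x)"

definition path_equiv :: "('a, nat^'k::finite) pgraph \<Rightarrow> 'a rel" where
  "path_equiv \<Lambda> = {(\<mu>, \<nu>). \<mu> \<in> arr \<Lambda> \<and> \<nu> \<in> arr \<Lambda> \<and> src \<Lambda> \<mu> = src \<Lambda> \<nu> \<and>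
     (\<forall>x\<in>inf_paths_from \<Lambda> {src \<Lambda> \<mu>}. prepend \<Lambda> \<mu> x = prepend \<Lambda> \<nu> x)}"

definition Per :: "('a, nat^'k::finite) pgraph \<Rightarrow> (int^'k) set" where
  "Per \<Lambda> = {int_vec (deg \<Lambda> \<mu>) - int_vec (deg \<Lambda> \<nu>) | \<mu> \<nu>. (\<mu>, \<nu>) \<in> path_equiv \<Lambda>}"

definition H_Per :: "('a, nat^'k::finite) pgraph \<Rightarrow> 'a set" where
  "H_Per \<Lambda> = {v \<in> objs \<Lambda>. \<forall>l\<in>arr \<Lambda>. \<forall>m. rng \<Lambda> l = v \<and> int_vec (deg \<Lambda> l) - int_vec m \<in> Per \<Lambda>
     \<longrightarrow> (\<exists>\<mu>\<in>paths_of_degree \<Lambda> v m. (l, \<mu>) \<in> path_equiv \<Lambda>)}"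

section \<open>The quotient graph\<close>

definition q_Per :: "('a, nat^'k::finite) pgraph \<Rightarrow> int^'k \<Rightarrow> (int^'k) set" where
  "q_Per \<Lambda> z = Per \<Lambda> #>\<^bsub>plus_monoid\<^esub> z"

text \<open>The submonoid \<open>q(N\<^sup>k)\<close> of the quotient group \<open>Z\<^sup>k / Per \<Lambda>\<close>.\<close>

definition q_monoid :: "('a, nat^'k::finite) pgraph \<Rightarrow> (int^'k) set monoid" where
  "q_monoid \<Lambda> = (plus_monoid Mod Per \<Lambda>)\<lparr>carrier := q_Per \<Lambda> ` range int_vec\<rparr>"

definition path_class :: "('a, nat^'k::finite) pgraph \<Rightarrow> 'a \<Rightarrow> 'a set" where
  "path_class \<Lambda> l = path_equiv \<Lambda> `` {l}"

text \<open>
  Here \<open>the_elem\<close> picks the common value on all representatives, i.e. it encodes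
  \<open>r([l]) = [r(l)]\<close>, \<open>s([l]) = [s(l)]\<close>, \<open>[l][m] = [lm]\<close> and \<open>d([l]) = q(d(l))\<close>.
\<close>

definition quotient_graph ::
    "('a, nat^'k::finite) pgraph \<Rightarrow> 'a set \<Rightarrow> ('a set, (int^'k) set) pgraph" where
  "quotient_graph \<Lambda> H =
     \<lparr>arr = {l \<in> arr \<Lambda>. rng \<Lambda> l \<in> H} // path_equiv \<Lambda>,
      rng = (\<lambda>X. the_elem ((\<lambda>l. path_class \<Lambda> (rng \<Lambda> l)) ` X)),
      src = (\<lambda>X. the_elem ((\<lambda>l. path_class \<Lambda> (src \<Lambda> l)) ` X)),
      cmp = (\<lambda>X Y. the_elem ((\<lambda>(l, m). path_class \<Lambda> (cmp \<Lambda> l m)) ` (X \<times> Y))),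
      deg = (\<lambda>X. the_elem ((\<lambda>l. q_Per \<Lambda> (int_vec (deg \<Lambda> l))) ` X))\<rparr>"

end

theory Submission
  imports Defs
begin

text \<open>
  Everything rests on the translation of \<open>\<mu> \<sim> \<nu>\<close> into an identity between shift maps.
  If \<open>\<mu> \<sim> \<nu>\<close> and \<open>x\<close> starts at the common source, then \<open>y = \<mu>x = \<nu>x\<close> is carried to \<open>x\<close> by the
  shifts by \<open>p = d(\<mu>)\<close> and by \<open>q = d(\<nu>)\<close>; as shifts commute, \<open>\<sigma>\<^sup>p\<close> and \<open>\<sigma>\<^sup>q\<close> agree on every infinite
  path from \<open>s(\<mu>)\<close> (\<open>periodic_at_source_if_equiv\<close>). Conversely, where \<open>\<sigma>\<^sup>p\<close> and \<open>\<sigma>\<^sup>q\<close> agree, two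
  factorisations \<open>ab = a'b'\<close> of one path with \<open>d(a) = p\<close> and \<open>d(a') = q\<close> have equivalent tails
  \<open>b \<sim> b'\<close> (\<open>equiv_of_periodic_at\<close>). Hence \<open>Per(\<Lambda>)\<close> is the set of all \<open>p - q\<close> such that \<open>\<sigma>\<^sup>p = \<sigma>\<^sup>q\<close>
  on the infinite paths from some vertex (\<open>Per_iff\<close>). Such an identity persists at all
  vertices downstream, two vertices of a maximal tail have a common descendant, and two identities
  at the same vertex can be composed: so \<open>Per(\<Lambda>)\<close> is a group.

  The heart of the matter is that \<open>H\<^bsub>Per\<^esub>\<close> is nonempty. For a single pair \<open>(p, m)\<close> with
  \<open>p - m \<in> Per(\<Lambda>)\<close>, let \<open>\<sigma>\<^sup>p\<close> and \<open>\<sigma>\<^sup>m\<close> agree on the paths from \<open>v\<close> and let \<open>\<tau>\<close> be a path of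
  degree \<open>m\<close> from \<open>v\<close>. Any \<open>g\<close> of degree \<open>p\<close> with range \<open>s(\<tau>)\<close> then has a partner of degree \<open>m\<close>:
  refactor \<open>\<tau>g = \<tau>'h\<close> with \<open>d(h) = m\<close> and compare the tails \<open>g\<close> and \<open>h\<close>. The room that \<open>\<tau>\<close>
  creates in front of \<open>g\<close> is essential, for at \<open>v\<close> itself the obvious candidate \<open>(gx)(0, m)\<close> might
  depend on \<open>x\<close>. The same works at every vertex downstream (\<open>exchangeable_if_Per\<close>). It remains to
  treat infinitely many pairs at one vertex. Partners of two composable paths compose, so
  it is enough to treat pairs that generate all others additively, and by Dickson's lemma
  finitely many suffice (\<open>finite_generators_of_saturated_pairs\<close>).

  The other claims follow formally. Equivalent paths of the same degree coincide, since both are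
  the initial segment of one infinite path. So above \<open>H\<^bsub>Per\<^esub>\<close> an element of the quotient has exactly
  one representative in each degree that lies over its own degree
  (\<open>class_representative_of_degree\<close>). This reduces the factorisation property of the quotient to
  that of \<open>\<Lambda>\<close>, and it says that \<open>\<lambda> \<mapsto> ([\<lambda>], d(\<lambda>))\<close> is a bijection onto the pullback.
\<close>

section \<open>Vectors of natural numbers and Dickson's lemma\<close>

lemma plus_monoid_simps [simp]:
  "carrier plus_monoid = UNIV" "x \<otimes>\<^bsub>plus_monoid\<^esub> y = x + y" "\<one>\<^bsub>plus_monoid\<^esub> = 0"
  by (simp_all add: plus_monoid_def)

lemma group_plus_monoid: "group (plus_monoid :: ('a::ab_group_add) monoid)"
proof (rule groupI)
  show "\<exists>y\<in>carrier plus_monoid. y \<otimes>\<^bsub>plus_monoid\<^esub> x = \<one>\<^bsub>plus_monoid\<^esub>" for x :: "'a"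
    by (auto intro: exI[of _ "- x"])
qed (auto simp: add.assoc)

lemma vec_le_iff_add: "m \<le> n \<longleftrightarrow> (\<exists>r. n = m + r)" for m n :: "nat^'k::finite"
proof
  assume "m \<le> n"
  then have "n = m + (n - m)" by (simp add: less_eq_vec_def vec_eq_iff)
  then show "\<exists>r. n = m + r" ..
qed (auto simp: less_eq_vec_def)

lemma vec_le_add [simp]: "m \<le> m + r" "m \<le> r + m" for m :: "nat^'k::finite"
  by (simp_all add: less_eq_vec_def)

lemma vec_zero_le [simp]: "0 \<le> m" for m :: "nat^'k::finite"
  by (simp add: less_eq_vec_def)

lemma vec_add_le_add_iff [simp]: "m + p \<le> n + p \<longleftrightarrow> m \<le> n" for m :: "nat^'k::finite"
  by (simp add: less_eq_vec_def)

lemma int_vec_add [simp]: "int_vec (m + n) = int_vec m + int_vec n"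
  by (simp add: int_vec_def vec_eq_iff)

lemma int_vec_zero [simp]: "int_vec 0 = 0"
  by (simp add: int_vec_def vec_eq_iff)

lemma int_vec_inject [simp]: "int_vec m = int_vec n \<longleftrightarrow> m = n"
  by (simp add: int_vec_def vec_eq_iff)

lemma nat_seq_mono_subseq:
  fixes f :: "nat \<Rightarrow> nat"
  obtains g :: "nat \<Rightarrow> nat" where "strict_mono g" "mono (\<lambda>n. f (g n))"
proof -
  obtain g :: "nat \<Rightarrow> nat" where g: "strict_mono g" "monoseq (\<lambda>n. f (g n))"
    using seq_monosub[of f] by auto
  show thesis
  proof (cases "mono (\<lambda>n. f (g n))")
    case True
    then show ?thesis using that g by blast
  next
    case False
    then have dec: "f (g n) \<le> f (g m)" if "m \<le> n" for m n
      using g(2) that unfolding monoseq_def mono_def by blast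
    define L where "L = (LEAST v. \<exists>n. v = f (g n))"
    have "\<exists>n. L = f (g n)" unfolding L_def by (rule LeastI_ex) auto
    then obtain N where N: "L = f (g N)" ..
    \<comment> \<open>A decreasing sequence of natural numbers is constant once it attains its least value.\<close>
    have "f (g n) = L" if "N \<le> n" for n
      using dec[OF that] N Least_le[of "\<lambda>v. \<exists>n. v = f (g n)" "f (g n)"]
      unfolding L_def by fastforce
    then have "mono (\<lambda>n. f (g (N + n)))" by (simp add: mono_def)
    moreover have "strict_mono (\<lambda>n. g (N + n))" using g(1) by (simp add: strict_mono_def)
    ultimately show ?thesis using that by blast
  qed
qed

lemma nat_seqs_mono_subseq:
  fixes f :: "'i \<Rightarrow> nat \<Rightarrow> nat"
  assumes "finite I"
  shows "\<exists>g :: nat \<Rightarrow> nat. strict_mono g \<and> (\<forall>i\<in>I. mono (\<lambda>n. f i (g n)))"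
  using assms
proof (induction I)
  case empty
  then show ?case using strict_mono_id by blast
next
  case (insert i I)
  then obtain g :: "nat \<Rightarrow> nat" where g: "strict_mono g" "\<forall>i\<in>I. mono (\<lambda>n. f i (g n))" by blast
  obtain h :: "nat \<Rightarrow> nat" where h: "strict_mono h" "mono (\<lambda>n. f i (g (h n)))"
    using nat_seq_mono_subseq[of "\<lambda>n. f i (g n)"] by blast
  have "mono (\<lambda>n. f j (g (h n)))" if "j \<in> I" for j
    using g(2) that strict_mono_mono[OF h(1)] by (simp add: mono_def)
  then show ?case
    using strict_mono_compose[OF g(1) h(1)] h(2) by (intro exI[of _ "\<lambda>n. g (h n)"]) auto
qed

text \<open>
  Dickson's lemma, for pairs of vectors: an infinite antichain would contain a sequence of distinct
  elements, and some subsequence of it is weakly increasing in every coordinate, so that its first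
  two members are comparable.
\<close>

lemma finite_antichain_of_vec_pairs:
  fixes M :: "((nat^'k::finite) \<times> (nat^'k)) set"
  assumes antichain: "\<And>a b. \<lbrakk>a \<in> M; b \<in> M; fst a \<le> fst b; snd a \<le> snd b\<rbrakk> \<Longrightarrow> a = b"
  shows "finite M"
proof (rule ccontr)
  assume "infinite M"
  then obtain e :: "nat \<Rightarrow> _" where e: "inj e" "range e \<subseteq> M"
    using infinite_countable_subset by blast
  define c where "c = (\<lambda>i n. case i of Inl j \<Rightarrow> fst (e n) $ (j::'k) | Inr j \<Rightarrow> snd (e n) $ (j::'k))"
  obtain g :: "nat \<Rightarrow> nat" where g: "strict_mono g" "\<And>i. mono (\<lambda>n. c i (g n))"
    using nat_seqs_mono_subseq[of UNIV c] by auto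
  have "fst (e (g 0)) \<le> fst (e (g 1))" "snd (e (g 0)) \<le> snd (e (g 1))"
    using monoD[OF g(2)[of "Inl _"], of 0 1] monoD[OF g(2)[of "Inr _"], of 0 1]
    by (simp_all add: less_eq_vec_def c_def)
  then have "e (g 0) = e (g 1)" using antichain e(2) by blast
  then show False using e(1) g(1) by (metis injD strict_mono_eq zero_neq_one)
qed

text \<open>
  The pairs with difference in a subgroup of \<open>\<int>\<^sup>k\<close> are the intended example. The minimal nonzero
  members form an antichain, and a member that is neither zero nor minimal is the sum of a smaller
  member and the difference, which the hypothesis keeps inside the family. The conclusion is
  stated as an induction principle because its use is to spread an additive property \<open>Q\<close> from
  finitely many pairs to all.
\<close>

lemma finite_generators_of_saturated_pairs:
  fixes S :: "((nat^'k::finite) \<times> (nat^'k)) set"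
  assumes diff: "\<And>a b c d. \<lbrakk>(a, b) \<in> S; (a + c, b + d) \<in> S\<rbrakk> \<Longrightarrow> (c, d) \<in> S"
  obtains M where "finite M" "M \<subseteq> S"
    "\<And>Q. \<lbrakk>Q 0 0; \<And>a b. (a, b) \<in> M \<Longrightarrow> Q a b;
           \<And>a b c d. \<lbrakk>Q a b; Q c d\<rbrakk> \<Longrightarrow> Q (a + c) (b + d)\<rbrakk> \<Longrightarrow> \<forall>(a, b)\<in>S. Q a b"
proof -
  define M where "M = {(a, b). (a, b) \<in> S \<and> (a, b) \<noteq> (0, 0) \<and>
     (\<forall>c d. (c, d) \<in> S \<longrightarrow> (c, d) \<noteq> (0, 0) \<longrightarrow> c \<le> a \<longrightarrow> d \<le> b \<longrightarrow> (c, d) = (a, b))}"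
  define size where "size = (\<lambda>(a :: nat^'k) (b :: nat^'k). (\<Sum>i\<in>UNIV. a $ i + b $ i))"
  have size_add: "size (a + c) (b + d) = size a b + size c d" for a b c d
    by (simp add: size_def sum.distrib)
  have size_0: "size a b = 0 \<longleftrightarrow> a = 0 \<and> b = 0" for a b
    by (auto simp: size_def vec_eq_iff)
  have "finite M"
    by (rule finite_antichain_of_vec_pairs) (auto simp: M_def)
  moreover have "M \<subseteq> S" by (auto simp: M_def)
  moreover have "\<forall>(a, b)\<in>S. Q a b"
    if Q: "Q 0 0" "\<And>a b. (a, b) \<in> M \<Longrightarrow> Q a b"
      "\<And>a b c d. \<lbrakk>Q a b; Q c d\<rbrakk> \<Longrightarrow> Q (a + c) (b + d)" for Q
  proof -
    have "(a, b) \<in> S \<Longrightarrow> Q a b" for a b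
    proof (induction "size a b" arbitrary: a b rule: less_induct)
      case less
      show ?case
      proof (cases "(a, b) = (0, 0) \<or> (a, b) \<in> M")
        case True
        then show ?thesis using Q by auto
      next
        case False
        then obtain c d where cd: "(c, d) \<in> S" "(c, d) \<noteq> (0, 0)" "c \<le> a" "d \<le> b" "(c, d) \<noteq> (a, b)"
          using less.prems unfolding M_def by blast
        obtain a' b' where ab: "a = c + a'" "b = d + b'"
          using cd(3,4) by (auto simp: vec_le_iff_add)
        have "(a', b') \<noteq> (0, 0)" using cd(5) ab by auto
        then have "size c d < size a b" "size a' b' < size a b"
          using cd(2) size_0[of c d] size_0[of a' b'] by (auto simp: ab size_add)
        moreover have "(a', b') \<in> S" using diff cd(1) less.prems ab by blast
        ultimately show ?thesis using less.hyps cd(1) Q(3) ab by blast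
      qed
    qed
    then show ?thesis by blast
  qed
  ultimately show thesis by (rule that)
qed

section \<open>Factorisation and prefixes\<close>

text \<open>
  Unique existence of a pair abbreviates a case distinction on one variable; these two rules
  let the factorisation property be handled through its two components.
\<close>

lemma ex1_pairI:
  assumes "P a b" "\<And>a' b'. P a' b' \<Longrightarrow> a' = a \<and> b' = b" shows "\<exists>!(a, b). P a b"
proof (rule ex1I[of _ "(a, b)"])
  show "case (a, b) of (a, b) \<Rightarrow> P a b" using assms(1) by simp
  fix y assume "case y of (a, b) \<Rightarrow> P a b"
  then show "y = (a, b)" using assms(2)[of "fst y" "snd y"] by (simp add: split_beta prod_eq_iff)
qed

lemma ex1_pairE:
  assumes "\<exists>!(a, b). P a b"
  obtains a b where "P a b" "\<forall>a' b'. P a' b' \<longrightarrow> a' = a \<and> b' = b"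
proof -
  obtain y where y: "case_prod P y" "\<forall>y'. case_prod P y' \<longrightarrow> y' = y"
    using assms by (rule ex1E)
  obtain a b where ab: "y = (a, b)" by (cases y)
  have "P a b" using y(1) ab by simp
  moreover have "\<forall>a' b'. P a' b' \<longrightarrow> a' = a \<and> b' = b"
    using y(2) ab by fastforce
  ultimately show thesis by (rule that)
qed

lemma shift_apply: "shift p x (m, n) = x (m + p, n + p)"
  by (simp add: shift_def)

lemma shift_shift: "shift p (shift q x) = shift (p + q) x"
  by (auto simp: shift_def add.assoc)

locale higher_rank_graph = P_graph "plus_monoid :: (nat^'k::finite) monoid" \<Lambda>
  for \<Lambda> :: "('a, nat^'k) pgraph"
begin

abbreviation "A \<equiv> arr \<Lambda>"
abbreviation "r \<equiv> rng \<Lambda>"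
abbreviation "s \<equiv> src \<Lambda>"
abbreviation "d \<equiv> deg \<Lambda>"
abbreviation comp (infixl "\<odot>" 70) where "f \<odot> g \<equiv> cmp \<Lambda> f g"

lemma obj_arr: "v \<in> objs \<Lambda> \<Longrightarrow> v \<in> A"
  and obj_r: "v \<in> objs \<Lambda> \<Longrightarrow> r v = v"
  and obj_s: "v \<in> objs \<Lambda> \<Longrightarrow> s v = v"
  by (auto simp: objs_def)

lemma obj_d: "v \<in> objs \<Lambda> \<Longrightarrow> d v = 0"
  using deg_objs by simp

lemma r_s [simp]: "f \<in> A \<Longrightarrow> r (s f) = s f"
  and s_s [simp]: "f \<in> A \<Longrightarrow> s (s f) = s f"
  and s_arr [simp]: "f \<in> A \<Longrightarrow> s f \<in> A"
  and s_r [simp]: "f \<in> A \<Longrightarrow> s (r f) = r f"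
  and r_r [simp]: "f \<in> A \<Longrightarrow> r (r f) = r f"
  and r_arr [simp]: "f \<in> A \<Longrightarrow> r f \<in> A"
  and d_r [simp]: "f \<in> A \<Longrightarrow> d (r f) = 0"
  and d_s [simp]: "f \<in> A \<Longrightarrow> d (s f) = 0"
  using src_objs[of f] rng_objs[of f] by (simp_all add: obj_arr obj_r obj_s obj_d)

lemma d_comp [simp]: "\<lbrakk>f \<in> A; g \<in> A; s f = r g\<rbrakk> \<Longrightarrow> d (f \<odot> g) = d f + d g"
  using deg_cmp by simp

declare cmp_closed [simp] rng_cmp [simp] src_cmp [simp] id_left [simp] id_right [simp]

lemma factor_ex:
  assumes "l \<in> A" "d l = p + q"
  obtains f g where "f \<in> A" "g \<in> A" "s f = r g" "d f = p" "d g = q" "l = f \<odot> g"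
proof -
  have "\<exists>!(\<eta>, \<zeta>). \<eta> \<in> A \<and> \<zeta> \<in> A \<and> s \<eta> = r \<zeta> \<and> d \<eta> = p \<and> d \<zeta> = q \<and> l = \<eta> \<odot> \<zeta>"
    by (rule factorisation) (use assms in simp_all)
  then obtain f g where "f \<in> A \<and> g \<in> A \<and> s f = r g \<and> d f = p \<and> d g = q \<and> l = f \<odot> g"
    by (rule ex1_pairE)
  then show thesis using that by blast
qed

lemma factor_unique:
  assumes "f \<in> A" "g \<in> A" "s f = r g" "f' \<in> A" "g' \<in> A" "s f' = r g'"
    and "d f = d f'" "f \<odot> g = f' \<odot> g'"
  shows "f = f'" "g = g'"
proof -
  have "d (f \<odot> g) = d f' + d g'" using assms d_comp by metis
  then have dg: "d g' = d g" using assms d_comp by (metis add_left_cancel)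
  have "\<exists>!(\<eta>, \<zeta>). \<eta> \<in> A \<and> \<zeta> \<in> A \<and> s \<eta> = r \<zeta> \<and> d \<eta> = d f \<and> d \<zeta> = d g
      \<and> f \<odot> g = \<eta> \<odot> \<zeta>"
    by (rule factorisation) (use assms(1-3) in simp_all)
  then obtain a b where ab: "\<forall>\<eta> \<zeta>. \<eta> \<in> A \<and> \<zeta> \<in> A \<and> s \<eta> = r \<zeta> \<and> d \<eta> = d f \<and> d \<zeta> = d g
      \<and> f \<odot> g = \<eta> \<odot> \<zeta> \<longrightarrow> \<eta> = a \<and> \<zeta> = b"
    by (rule ex1_pairE)
  have "f = a \<and> g = b" using ab[rule_format, of f g] assms(1-3) by blast
  moreover have "f' = a \<and> g' = b" using ab[rule_format, of f' g'] assms dg by metis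
  ultimately show "f = f'" "g = g'" by simp_all
qed

text \<open>The two trivial factorisations \<open>r(l) l = l = l s(l)\<close> have the same degrees if \<open>d(l) = 0\<close>.\<close>

lemma deg_zero_obj: "l \<in> objs \<Lambda>" "r l = l" "s l = l" if "l \<in> A" "d l = 0"
proof -
  have "r l \<odot> l = l \<odot> s l" using that by simp
  then have "r l = l" "l = s l"
    by (rule factor_unique[rotated -1]; use that in simp)+
  then show "l \<in> objs \<Lambda>" "r l = l" "s l = l" using that by (auto simp: objs_def)
qed

text \<open>
  The relation encodes \<open>f = l(0, d(f))\<close>. By unique factorisation, a path has exactly one prefix of
  each degree below its own.
\<close>

definition prefix :: "'a \<Rightarrow> 'a \<Rightarrow> bool" where
  "prefix f l \<longleftrightarrow> f \<in> A \<and> (\<exists>g\<in>A. s f = r g \<and> l = f \<odot> g)"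

lemma prefix_arr: "prefix f l \<Longrightarrow> f \<in> A \<and> l \<in> A"
  by (auto simp: prefix_def)

lemma prefix_comp: "\<lbrakk>f \<in> A; g \<in> A; s f = r g\<rbrakk> \<Longrightarrow> prefix f (f \<odot> g)"
  by (auto simp: prefix_def)

lemma prefix_refl: "l \<in> A \<Longrightarrow> prefix l l"
  by (auto simp: prefix_def intro!: bexI[of _ "s l"])

lemma prefix_ex:
  assumes "l \<in> A" "n \<le> d l"
  obtains f where "prefix f l" "d f = n"
  using assms factor_ex[of l n] prefix_comp by (metis vec_le_iff_add)

lemma prefix_unique: "\<lbrakk>prefix f l; prefix f' l; d f = d f'\<rbrakk> \<Longrightarrow> f = f'"
  unfolding prefix_def using factor_unique by metis

lemma prefix_trans:
  assumes "prefix f g" "prefix g h" shows "prefix f h"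
proof -
  obtain a b where "f \<in> A" "a \<in> A" "s f = r a" "g = f \<odot> a" "b \<in> A" "s g = r b" "h = g \<odot> b"
    using assms by (auto simp: prefix_def)
  then have "a \<odot> b \<in> A" "s f = r (a \<odot> b)" "h = f \<odot> (a \<odot> b)"
    by (simp_all add: cmp_assoc)
  then show ?thesis unfolding prefix_def using \<open>f \<in> A\<close> by blast
qed

lemma prefix_of_common:
  assumes "prefix f l" "prefix g l" "d f \<le> d g" shows "prefix f g"
proof -
  obtain f' where "prefix f' g" "d f' = d f"
    using prefix_ex[of g "d f"] assms prefix_arr by blast
  then show ?thesis using assms prefix_unique prefix_trans by metis
qed

section \<open>Infinite paths\<close>

lemma inf_path_iff: "x \<in> inf_paths \<Lambda> \<longleftrightarrow>
   x \<in> extensional (arr Omega) \<and>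
   (\<forall>m n. m \<le> n \<longrightarrow> x (m, n) \<in> A \<and> r (x (m, n)) = x (m, m) \<and> s (x (m, n)) = x (n, n)
      \<and> d (x (m, n)) = n - m) \<and>
   (\<forall>m n p. m \<le> n \<longrightarrow> n \<le> p \<longrightarrow> x (m, p) = x (m, n) \<odot> x (n, p))"
  unfolding inf_paths_def degree_functor_def Omega_def
  by (simp add: split_paired_Ball_Sigma Ball_def)

lemma inf_path_ext: "x \<in> inf_paths \<Lambda> \<Longrightarrow> x \<in> extensional (arr Omega)"
  unfolding inf_path_iff by blast

lemma inf_pathD:
  assumes "x \<in> inf_paths \<Lambda>" "m \<le> n"
  shows "x (m, n) \<in> A" "r (x (m, n)) = x (m, m)" "s (x (m, n)) = x (n, n)" "d (x (m, n)) = n - m"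
  using assms unfolding inf_path_iff by blast+

lemma inf_path_init:
  assumes "x \<in> inf_paths \<Lambda>"
  shows "x (0, n) \<in> A" "r (x (0, n)) = x (0, 0)" "s (x (0, n)) = x (n, n)" "d (x (0, n)) = n"
  using inf_pathD[OF assms, of 0 n] by auto

lemma inf_path_comp:
  "\<lbrakk>x \<in> inf_paths \<Lambda>; m \<le> n; n \<le> p\<rbrakk> \<Longrightarrow> x (m, n) \<odot> x (n, p) = x (m, p)"
  unfolding inf_path_iff by metis

lemma inf_path_prefix:
  assumes "x \<in> inf_paths \<Lambda>" "m \<le> n" shows "prefix (x (0, m)) (x (0, n))"
  using prefix_comp[of "x (0, m)" "x (m, n)"] inf_path_comp[OF assms(1), of 0 m n]
    inf_path_init[OF assms(1), of m] inf_pathD[OF assms] assms(2) by simp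

lemma inf_path_eqI:
  assumes x: "x \<in> inf_paths \<Lambda>" and y: "y \<in> inf_paths \<Lambda>"
    and eq: "\<And>n. x (0, p + n) = y (0, p + n)"
  shows "x = y"
proof -
  have init: "x (0, n) = y (0, n)" for n
    using inf_path_prefix[OF x, of n "p + n"] inf_path_prefix[OF y, of n "p + n"]
      prefix_unique[of "x (0, n)" "x (0, p + n)" "y (0, n)"]
    by (simp add: eq inf_path_init[OF x] inf_path_init[OF y])
  have "x (m, n) = y (m, n)" if "m \<le> n" for m n
    using factor_unique(2)[of "x (0, m)" "x (m, n)" "y (0, m)" "y (m, n)"]
      inf_path_init[OF x, of m] inf_path_init[OF y, of m] inf_pathD[OF x that] inf_pathD[OF y that]
      inf_path_comp[OF x _ that, of 0] inf_path_comp[OF y _ that, of 0] by (simp add: init)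
  then show ?thesis
    using inf_path_ext[OF x] inf_path_ext[OF y]
    by (intro extensionalityI[of x "arr Omega" y]) (auto simp: Omega_def)
qed

text \<open>
  An infinite path is determined by its initial segments, and any coherent family \<open>y\<close> of initial
  segments occurs: the value at \<open>(m, n)\<close> is the unique \<open>g\<close> with \<open>y(n) = y(m) g\<close>.
\<close>

lemma inf_path_of_initial_segments:
  assumes yd: "\<And>n. d (y n) = n" and ypre: "\<And>m n. m \<le> n \<Longrightarrow> prefix (y m) (y n)"
  obtains x where "x \<in> inf_paths \<Lambda>" "\<And>n. x (0, n) = y n"
proof -
  have yA: "y n \<in> A" for n using ypre[of n n] prefix_arr by auto
  have "\<exists>g. g \<in> A \<and> s (y m) = r g \<and> y n = y m \<odot> g" if "m \<le> n" for m n
    using ypre[OF that] by (auto simp: prefix_def)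
  then obtain g where g: "g m n \<in> A" "s (y m) = r (g m n)" "y n = y m \<odot> g m n"
    if "m \<le> n" for m n by metis
  define x where "x = restrict (\<lambda>(m, n). g m n) (arr Omega)"
  have x: "x (m, n) = g m n" if "m \<le> n" for m n
    using that by (simp add: x_def Omega_def)
  have gs: "s (g m n) = s (y n)" if "m \<le> n" for m n
    using g[OF that] yA[of m] by simp
  have gd: "d (g m n) = n - m" if "m \<le> n" for m n
  proof -
    have "d (y n) = d (y m) + d (g m n)" using g[OF that] yA[of m] d_comp by metis
    then have "n = m + d (g m n)" by (simp add: yd)
    then show ?thesis by (metis add_diff_cancel_left')
  qed
  have gid: "g n n = s (y n)" for n
    using gd[of n n] g[of n n] gs[of n n] deg_zero_obj[of "g n n"] by auto
  have gcomp: "g m p = g m n \<odot> g n p" if "m \<le> n" "n \<le> p" for m n p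
  proof -
    have mp: "m \<le> p" using that by (meson order_trans)
    have "y m \<odot> g m p = y m \<odot> (g m n \<odot> g n p)"
      using g[OF mp] g[OF that(1)] g[OF that(2)] gs[OF that(1)] yA[of m] cmp_assoc by metis
    moreover have "g m n \<odot> g n p \<in> A" "s (y m) = r (g m n \<odot> g n p)"
      using g(1,2)[OF that(1)] g(1,2)[OF that(2)] gs[OF that(1)] by simp_all
    ultimately show ?thesis
      using factor_unique(2) g(1,2)[OF mp] yA by metis
  qed
  have "x \<in> inf_paths \<Lambda>"
    unfolding inf_path_iff
  proof (intro conjI allI impI)
    show "x \<in> extensional (arr Omega)" by (simp add: x_def)
    show "x (m, p) = x (m, n) \<odot> x (n, p)" if "m \<le> n" "n \<le> p" for m n p
      using gcomp[OF that] order_trans[OF that] that by (simp add: x)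
  qed (use g gs gd gid in \<open>auto simp: x\<close>)
  moreover have "x (0, n) = y n" for n
  proof -
    have "y 0 \<odot> g 0 n = g 0 n"
      using deg_zero_obj[of "y 0"] yd[of 0] yA[of 0] g[of 0 n] id_left[of "g 0 n"] by simp
    then show ?thesis using g[of 0 n] by (simp add: x)
  qed
  ultimately show thesis by (rule that)
qed

text \<open>
  It is enough to know the initial segments for a cofinal set of degrees. Both the prepending of a
  finite path and the existence of infinite paths are instances.
\<close>

lemma inf_path_of_directed_set:
  assumes dir: "\<And>f g. \<lbrakk>f \<in> L; g \<in> L\<rbrakk> \<Longrightarrow> \<exists>h\<in>L. prefix f h \<and> prefix g h"
    and cofinal: "\<And>n. \<exists>f\<in>L. n \<le> d f"
  obtains x where "x \<in> inf_paths \<Lambda>" "\<And>f. f \<in> L \<Longrightarrow> x (0, d f) = f"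
proof -
  have LA: "f \<in> L \<Longrightarrow> f \<in> A" for f using dir[of f f] prefix_arr by blast
  have "\<exists>a. d a = n \<and> (\<exists>f\<in>L. prefix a f)" for n
    using cofinal[of n] LA prefix_ex by metis
  then obtain y where y: "d (y n) = n" "\<exists>f\<in>L. prefix (y n) f" for n by metis
  have pre: "prefix a b" if "f \<in> L" "prefix a f" "g \<in> L" "prefix b g" "d a \<le> d b" for a b f g
  proof -
    obtain h where "prefix f h" "prefix g h" using dir \<open>f \<in> L\<close> \<open>g \<in> L\<close> by blast
    then show ?thesis using that prefix_trans prefix_of_common by metis
  qed
  obtain x where x: "x \<in> inf_paths \<Lambda>" "\<And>n. x (0, n) = y n"
  proof (rule inf_path_of_initial_segments[of y])
    show "prefix (y m) (y n)" if "m \<le> n" for m n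
      using y(2)[of m] y(2)[of n] pre that y(1) by metis
  qed (use y in auto)
  have "x (0, d f) = f" if "f \<in> L" for f
  proof -
    have "prefix (y (d f)) f"
      using y[of "d f"] pre[of _ "y (d f)" f f] that prefix_refl[OF LA[OF that]] by auto
    then show ?thesis
      using prefix_unique[of "y (d f)" f f] prefix_refl[OF LA[OF that]] y(1) x(2) by simp
  qed
  then show thesis using x that by blast
qed

lemma shift_in_inf_paths:
  assumes x: "x \<in> inf_paths \<Lambda>" shows "shift p x \<in> inf_paths \<Lambda>"
  unfolding inf_path_iff shift_apply
proof (intro conjI allI impI)
  show "shift p x \<in> extensional (arr Omega)"
    using inf_path_ext[OF x] by (auto simp: extensional_def Omega_def shift_def)
next
  fix m n :: "nat^'k" assume "m \<le> n"
  then have mn: "m + p \<le> n + p" by simp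
  have "(n + p) - (m + p) = n - m" by (simp add: vec_eq_iff)
  then show "x (m + p, n + p) \<in> A" "r (x (m + p, n + p)) = x (m + p, m + p)"
    "s (x (m + p, n + p)) = x (n + p, n + p)" "d (x (m + p, n + p)) = n - m"
    using inf_pathD[OF x mn] by auto
next
  fix m n q :: "nat^'k" assume "m \<le> n" "n \<le> q"
  then show "x (m + p, q + p) = x (m + p, n + p) \<odot> x (n + p, q + p)"
    by (intro inf_path_comp[OF x, symmetric]) simp_all
qed

text \<open>The paths \<open>l x(0, n)\<close> increase with \<open>n\<close> and their degrees \<open>d(l) + n\<close> are cofinal.\<close>

lemma ex_prepend:
  assumes l: "l \<in> A" and x: "x \<in> inf_paths \<Lambda>" "x (0, 0) = s l"
  obtains y where "y \<in> inf_paths \<Lambda>" "y (0, d l) = l" "shift (d l) y = x"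
proof -
  define f where "f n = l \<odot> x (0, n)" for n
  have f: "f n \<in> A" "d (f n) = d l + n" for n
    using l x(2) inf_path_init[OF x(1), of n] by (simp_all add: f_def)
  have fpre: "prefix (f m) (f n)" if "m \<le> n" for m n
  proof -
    note xm = inf_path_init(1-3)[OF x(1), of m] and xmn = inf_pathD(1-3)[OF x(1) that]
    have "f n = l \<odot> (x (0, m) \<odot> x (m, n))"
      using inf_path_comp[OF x(1) _ that, of 0] by (simp add: f_def)
    also have "\<dots> = f m \<odot> x (m, n)"
      unfolding f_def using xm xmn l x(2) by (intro cmp_assoc[symmetric]) auto
    finally have "f n = f m \<odot> x (m, n)" .
    moreover have "s (f m) = r (x (m, n))"
      unfolding f_def using xm xmn l x(2) by (subst src_cmp) auto
    ultimately show ?thesis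
      using prefix_comp[of "f m" "x (m, n)"] f(1)[of m] xmn(1) by simp
  qed
  obtain y where y: "y \<in> inf_paths \<Lambda>" "\<And>n. y (0, d (f n)) = f n"
  proof (rule inf_path_of_directed_set[of "range f"])
    show "\<exists>h\<in>range f. prefix a h \<and> prefix b h" if "a \<in> range f" "b \<in> range f" for a b
      using that fpre vec_le_add by blast
    show "\<exists>h\<in>range f. n \<le> d h" for n
      using f(2)[of n] by (auto intro!: exI[of _ n])
  qed auto
  have init: "y (0, d l) = l"
    using y(2)[of 0] f(2)[of 0] l x by (simp add: f_def)
  have "y (d l, d l + n) = x (0, n)" for n
  proof (rule factor_unique(2)[of l _ l])
    show "l \<odot> y (d l, d l + n) = l \<odot> x (0, n)"
      using y(2)[of n] f(2)[of n] init inf_path_comp[OF y(1), of 0 "d l" "d l + n"]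
      by (simp add: f_def)
    show "y (d l, d l + n) \<in> A" "x (0, n) \<in> A" "s l = r (x (0, n))"
      using inf_pathD(1)[OF y(1), of "d l" "d l + n"] inf_path_init(1,2)[OF x(1), of n] x(2)
      by auto
    show "s l = r (y (d l, d l + n))"
      using inf_pathD(2)[OF y(1), of "d l" "d l + n"] inf_path_init(3)[OF y(1), of "d l"] init
      by simp
  qed (use l in auto)
  then have "shift (d l) y = x"
    using inf_path_eqI[of "shift (d l) y" x 0] x(1) shift_in_inf_paths[OF y(1)]
    by (simp add: shift_apply add.commute)
  then show thesis using y(1) init that by blast
qed

lemma inf_path_eq_if_init_and_shift_eq:
  assumes x: "x \<in> inf_paths \<Lambda>" and y: "y \<in> inf_paths \<Lambda>"
    and "x (0, p) = y (0, p)" "shift p x = shift p y"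
  shows "x = y"
proof (rule inf_path_eqI[OF x y, of p])
  fix n
  have "x (p, p + n) = y (p, p + n)"
    using fun_cong[OF assms(4), of "(0, n)"] by (simp add: shift_apply add.commute)
  then show "x (0, p + n) = y (0, p + n)"
    using inf_path_comp[OF x, of 0 p "p + n"] inf_path_comp[OF y, of 0 p "p + n"] assms(3) by simp
qed

lemma prepend_unique:
  assumes "y \<in> inf_paths \<Lambda>" "y (0, d l) = l" "shift (d l) y = x"
  shows "prepend \<Lambda> l x = y"
  unfolding prepend_def
proof (rule the_equality)
  show "y \<in> inf_paths \<Lambda> \<and> y (0, d l) = l \<and> shift (d l) y = x"
    using assms by blast
next
  fix z assume "z \<in> inf_paths \<Lambda> \<and> z (0, d l) = l \<and> shift (d l) z = x"
  then show "z = y"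
    using assms by (intro inf_path_eq_if_init_and_shift_eq[of z y "d l"]) simp_all
qed

lemma prepend:
  assumes "l \<in> A" "x \<in> inf_paths \<Lambda>" "x (0, 0) = s l"
  shows "prepend \<Lambda> l x \<in> inf_paths \<Lambda>" "prepend \<Lambda> l x (0, d l) = l" "shift (d l) (prepend \<Lambda> l x) = x"
proof -
  obtain y where "y \<in> inf_paths \<Lambda>" "y (0, d l) = l" "shift (d l) y = x"
    using ex_prepend[OF assms] .
  moreover from this have "prepend \<Lambda> l x = y" by (rule prepend_unique)
  ultimately show "prepend \<Lambda> l x \<in> inf_paths \<Lambda>" "prepend \<Lambda> l x (0, d l) = l"
    "shift (d l) (prepend \<Lambda> l x) = x" by simp_all
qed

lemma prepend_origin: "prepend \<Lambda> l x (0, 0) = r l"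
  if "l \<in> A" "x \<in> inf_paths \<Lambda>" "x (0, 0) = s l"
  using inf_path_init(2)[OF prepend(1)[OF that], of "d l"] prepend(2)[OF that] by simp

lemma prepend_init_shift: "x \<in> inf_paths \<Lambda> \<Longrightarrow> prepend \<Lambda> (x (0, p)) (shift p x) = x"
  using prepend_unique[of x "x (0, p)"] inf_path_init(4)[of x p] by simp

lemma shift_origin: "x \<in> inf_paths \<Lambda> \<Longrightarrow> shift p x (0, 0) = s (x (0, p))"
  using inf_path_init(3)[of x p] by (simp add: shift_apply)

lemma prepend_comp:
  assumes "f \<in> A" "g \<in> A" "s f = r g" "x \<in> inf_paths \<Lambda>" "x (0, 0) = s g"
  shows "prepend \<Lambda> (f \<odot> g) x = prepend \<Lambda> f (prepend \<Lambda> g x)"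
proof (rule prepend_unique)
  let ?y = "prepend \<Lambda> g x" and ?z = "prepend \<Lambda> f (prepend \<Lambda> g x)"
  note y = prepend[OF assms(2,4,5)] prepend_origin[OF assms(2,4,5)]
  have z: "?z \<in> inf_paths \<Lambda>" "?z (0, d f) = f" "shift (d f) ?z = ?y"
    using prepend[of f ?y] assms(1,3) y(1,4) by simp_all
  show "?z \<in> inf_paths \<Lambda>" by (rule z)
  have "shift (d g + d f) ?z = x" by (simp only: shift_shift[symmetric] z(3) y(3))
  then show "shift (d (f \<odot> g)) ?z = x"
    by (simp only: d_comp[OF assms(1-3)] add.commute)
  have "?z (d f, d f + d g) = g"
    using y(2) z(3) by (metis add.commute add_0 shift_apply)
  then have "?z (0, d f + d g) = f \<odot> g"
    using inf_path_comp[OF z(1), of 0 "d f" "d f + d g"] z(2) by simp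
  then show "?z (0, d (f \<odot> g)) = f \<odot> g"
    by (simp only: d_comp[OF assms(1-3)])
qed

end

locale row_finite_higher_rank_graph = higher_rank_graph \<Lambda>
  for \<Lambda> :: "('a, nat^'k::finite) pgraph" +
  assumes row_finite_no_sources: "row_finite_no_sources \<Lambda>"
begin

lemma no_sources:
  assumes "v \<in> objs \<Lambda>"
  obtains l where "l \<in> A" "r l = v" "d l = n"
  using row_finite_no_sources assms unfolding row_finite_no_sources_def paths_of_degree_def by blast

text \<open>
  Without sources, a path can be prolonged again and again by paths of degree \<open>(1, \<dots>, 1)\<close>. The
  degrees reached are the constant vectors, which are cofinal; the sum of the entries of a vector
  provides a bound for it.
\<close>

lemma ex_inf_path:
  assumes v: "v \<in> objs \<Lambda>"
  obtains x where "x \<in> inf_paths \<Lambda>" "x (0, 0) = v"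
proof -
  define one :: "nat^'k" where "one = (\<chi> i. 1)"
  have "\<exists>e. \<forall>l\<in>A. e l \<in> A \<and> r (e l) = s l \<and> d (e l) = one"
    by (meson no_sources src_objs)
  then obtain e where e: "e l \<in> A" "r (e l) = s l" "d (e l) = one" if "l \<in> A" for l by metis
  define f where "f = rec_nat v (\<lambda>_ l. l \<odot> e l)"
  have f_Suc: "f (Suc n) = f n \<odot> e (f n)" for n by (simp add: f_def)
  have f: "f n \<in> A \<and> r (f n) = v \<and> d (f n) = (\<chi> i. n)" for n
  proof (induction n)
    case 0
    then show ?case using v by (simp add: f_def obj_arr obj_r obj_d vec_eq_iff)
  next
    case (Suc n)
    then show ?case using e[of "f n"] by (simp add: f_Suc one_def vec_eq_iff)
  qed
  have fpre: "prefix (f m) (f n)" if "m \<le> n" for m n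
    using that
  proof (induction rule: dec_induct)
    case base
    then show ?case using f prefix_refl by simp
  next
    case (step n)
    then show ?case using f_Suc e[of "f n"] f[of n] prefix_comp prefix_trans by metis
  qed
  obtain x where x: "x \<in> inf_paths \<Lambda>" "\<And>n. x (0, d (f n)) = f n"
  proof (rule inf_path_of_directed_set[of "range f"])
    show "\<exists>h\<in>range f. prefix a h \<and> prefix b h" if "a \<in> range f" "b \<in> range f" for a b
      using that fpre le_add1 le_add2 by blast
    show "\<exists>h\<in>range f. n \<le> d h" for n
      using f member_le_sum[of _ UNIV "\<lambda>i. n $ i"]
      by (auto simp: less_eq_vec_def intro!: exI[of _ "\<Sum>i\<in>UNIV. n $ i"])
  qed auto
  have "x (0, 0) = v"
    using inf_path_init(2)[OF x(1), of "d (f 0)"] x(2)[of 0] f[of 0] by simp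
  then show thesis using x that by blast
qed

end

section \<open>Equivalence of paths and periodicity of shifts\<close>

context row_finite_higher_rank_graph
begin

abbreviation equiv_paths (infix "\<sim>" 50) where "\<mu> \<sim> \<nu> \<equiv> (\<mu>, \<nu>) \<in> path_equiv \<Lambda>"

lemma equiv_paths_iff: "\<mu> \<sim> \<nu> \<longleftrightarrow> \<mu> \<in> A \<and> \<nu> \<in> A \<and> s \<mu> = s \<nu> \<and>
   (\<forall>x\<in>inf_paths \<Lambda>. x (0, 0) = s \<mu> \<longrightarrow> prepend \<Lambda> \<mu> x = prepend \<Lambda> \<nu> x)"
  by (auto simp: path_equiv_def inf_paths_from_def)

lemma equiv_arr: "\<mu> \<sim> \<nu> \<Longrightarrow> \<mu> \<in> A \<and> \<nu> \<in> A"
  and equiv_s: "\<mu> \<sim> \<nu> \<Longrightarrow> s \<mu> = s \<nu>"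
  by (auto simp: equiv_paths_iff)

lemma equiv_prepend:
  "\<lbrakk>\<mu> \<sim> \<nu>; x \<in> inf_paths \<Lambda>; x (0, 0) = s \<mu>\<rbrakk> \<Longrightarrow> prepend \<Lambda> \<mu> x = prepend \<Lambda> \<nu> x"
  unfolding equiv_paths_iff by blast

lemma equivI_prepend:
  assumes "\<mu> \<in> A" "\<nu> \<in> A" "s \<mu> = s \<nu>"
    and "\<And>x. \<lbrakk>x \<in> inf_paths \<Lambda>; x (0, 0) = s \<mu>\<rbrakk> \<Longrightarrow> prepend \<Lambda> \<mu> x = prepend \<Lambda> \<nu> x"
  shows "\<mu> \<sim> \<nu>"
  unfolding equiv_paths_iff using assms by blast

lemma equiv_path_equiv: "equiv A (path_equiv \<Lambda>)"
  by (rule equivI) (auto simp: equiv_paths_iff refl_on_def sym_def trans_def)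

lemma equiv_refl: "\<mu> \<in> A \<Longrightarrow> \<mu> \<sim> \<mu>"
  and equiv_sym: "\<mu> \<sim> \<nu> \<Longrightarrow> \<nu> \<sim> \<mu>"
  and equiv_trans: "\<lbrakk>\<mu> \<sim> \<nu>; \<nu> \<sim> \<rho>\<rbrakk> \<Longrightarrow> \<mu> \<sim> \<rho>"
  using equiv_path_equiv unfolding equiv_def refl_on_def sym_def trans_def by blast+

lemma equiv_obtain_inf_path:
  assumes "\<mu> \<sim> \<nu>"
  obtains x where "x \<in> inf_paths \<Lambda>" "x (0, 0) = s \<mu>" "x (0, 0) = s \<nu>"
    "prepend \<Lambda> \<mu> x = prepend \<Lambda> \<nu> x"
  using ex_inf_path[OF src_objs] equiv_arr equiv_s equiv_prepend assms by metis

lemma equiv_r: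
  assumes "\<mu> \<sim> \<nu>" shows "r \<mu> = r \<nu>"
proof -
  obtain x where x: "x \<in> inf_paths \<Lambda>" "x (0, 0) = s \<mu>" "x (0, 0) = s \<nu>"
    "prepend \<Lambda> \<mu> x = prepend \<Lambda> \<nu> x"
    using equiv_obtain_inf_path[OF assms] .
  have "r \<mu> = prepend \<Lambda> \<mu> x (0, 0)"
    using prepend_origin[OF _ x(1,2)] equiv_arr[OF assms] by simp
  also have "\<dots> = r \<nu>"
    unfolding x(4) using prepend_origin[OF _ x(1,3)] equiv_arr[OF assms] by simp
  finally show ?thesis .
qed

text \<open>Both paths are the initial segment of the same degree of one infinite path \<open>\<mu>x = \<nu>x\<close>.\<close>

lemma equiv_same_degree:
  assumes "\<mu> \<sim> \<nu>" "d \<mu> = d \<nu>" shows "\<mu> = \<nu>"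
proof -
  obtain x where x: "x \<in> inf_paths \<Lambda>" "x (0, 0) = s \<mu>" "x (0, 0) = s \<nu>"
    "prepend \<Lambda> \<mu> x = prepend \<Lambda> \<nu> x"
    using equiv_obtain_inf_path[OF assms(1)] .
  have "\<mu> = prepend \<Lambda> \<mu> x (0, d \<mu>)"
    using prepend(2)[OF _ x(1,2)] equiv_arr[OF assms(1)] by simp
  also have "\<dots> = \<nu>"
    unfolding x(4) assms(2) using prepend(2)[OF _ x(1,3)] equiv_arr[OF assms(1)] by simp
  finally show ?thesis .
qed

lemma equiv_comp:
  assumes "f \<sim> f'" "g \<sim> g'" "s f = r g"
  shows "f \<odot> g \<sim> f' \<odot> g'"
proof -
  have A: "f \<in> A" "f' \<in> A" "g \<in> A" "g' \<in> A" "s f' = r g'" "s g = s g'"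
    using assms equiv_arr equiv_s equiv_r by auto
  show ?thesis
  proof (rule equivI_prepend)
    fix x assume x: "x \<in> inf_paths \<Lambda>" "x (0, 0) = s (f \<odot> g)"
    then have x0: "x (0, 0) = s g" using A assms(3) by simp
    have x0': "x (0, 0) = s g'" using x0 A by simp
    have y: "prepend \<Lambda> g x \<in> inf_paths \<Lambda>" "prepend \<Lambda> g x (0, 0) = s f"
      using prepend(1)[OF A(3) x(1) x0] prepend_origin[OF A(3) x(1) x0] assms(3) by simp_all
    have "prepend \<Lambda> (f \<odot> g) x = prepend \<Lambda> f (prepend \<Lambda> g x)"
      by (rule prepend_comp[OF A(1,3) assms(3) x(1) x0])
    also have "\<dots> = prepend \<Lambda> f' (prepend \<Lambda> g x)"
      by (rule equiv_prepend[OF assms(1) y])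
    also have "\<dots> = prepend \<Lambda> f' (prepend \<Lambda> g' x)"
      by (simp only: equiv_prepend[OF assms(2) x(1) x0])
    also have "\<dots> = prepend \<Lambda> (f' \<odot> g') x"
      by (rule prepend_comp[OF A(2,4,5) x(1) x0', symmetric])
    finally show "prepend \<Lambda> (f \<odot> g) x = prepend \<Lambda> (f' \<odot> g') x" .
  qed (use A assms(3) in auto)
qed

lemma equiv_cancel_left:
  assumes A: "f \<in> A" "\<mu> \<in> A" "\<nu> \<in> A" "s f = r \<mu>" "s f = r \<nu>" and eq: "f \<odot> \<mu> \<sim> f \<odot> \<nu>"
  shows "\<mu> \<sim> \<nu>"
proof -
  have s: "s \<mu> = s \<nu>" using equiv_s[OF eq] A by simp
  have "prepend \<Lambda> \<mu> x = prepend \<Lambda> \<nu> x" if x: "x \<in> inf_paths \<Lambda>" "x (0, 0) = s \<mu>" for x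
  proof -
    let ?y = "prepend \<Lambda> \<mu> x" and ?z = "prepend \<Lambda> \<nu> x"
    have x': "x (0, 0) = s \<nu>" "x (0, 0) = s (f \<odot> \<mu>)" using x(2) s A by simp_all
    have y: "?y \<in> inf_paths \<Lambda>" "?y (0, 0) = s f"
      using prepend(1)[OF A(2) x] prepend_origin[OF A(2) x] A(4) by simp_all
    have z: "?z \<in> inf_paths \<Lambda>" "?z (0, 0) = s f"
      using prepend(1)[OF A(3) x(1) x'(1)] prepend_origin[OF A(3) x(1) x'(1)] A(5) by simp_all
    have "prepend \<Lambda> f ?y = prepend \<Lambda> f ?z"
      using equiv_prepend[OF eq x(1) x'(2)] prepend_comp[OF A(1,2,4) x]
        prepend_comp[OF A(1,3,5) x(1) x'(1)] by simp
    then show ?thesis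
      using prepend(3)[OF A(1) y] prepend(3)[OF A(1) z] by metis
  qed
  then show ?thesis using A s equivI_prepend by blast
qed

definition periodic_at :: "nat^'k \<Rightarrow> nat^'k \<Rightarrow> 'a \<Rightarrow> bool" where
  "periodic_at p q v \<longleftrightarrow> (\<forall>x\<in>inf_paths \<Lambda>. x (0, 0) = v \<longrightarrow> shift p x = shift q x)"

lemma periodic_at_zero: "periodic_at 0 0 v"
  and periodic_at_sym: "periodic_at p q v \<Longrightarrow> periodic_at q p v"
  by (auto simp: periodic_at_def)

text \<open>Every \<open>x\<close> from \<open>s(l)\<close> is a shift of the path \<open>lx\<close> from \<open>r(l)\<close>, and shifts commute.\<close>

lemma periodic_at_downstream:
  assumes "periodic_at p q (r l)" "l \<in> A" shows "periodic_at p q (s l)"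
  unfolding periodic_at_def
proof (intro ballI impI)
  fix x assume x: "x \<in> inf_paths \<Lambda>" "x (0, 0) = s l"
  let ?y = "prepend \<Lambda> l x"
  have "shift p ?y = shift q ?y"
    using assms prepend(1)[OF assms(2) x] prepend_origin[OF assms(2) x]
    by (simp add: periodic_at_def)
  then have "shift p (shift (d l) ?y) = shift q (shift (d l) ?y)"
    by (metis shift_shift add.commute)
  then show "shift p x = shift q x" by (simp only: prepend(3)[OF assms(2) x])
qed

lemma periodic_at_add:
  assumes "periodic_at p q v" "periodic_at p' q' v"
  shows "periodic_at (p + p') (q + q') v"
  unfolding periodic_at_def
proof (intro ballI impI)
  fix x assume "x \<in> inf_paths \<Lambda>" "x (0, 0) = v"
  then have "shift p x = shift q x" "shift p' x = shift q' x"
    using assms by (auto simp: periodic_at_def)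
  then show "shift (p + p') x = shift (q + q') x"
    by (metis shift_shift add.commute)
qed

text \<open>
  The path \<open>y = \<mu>x = \<nu>x\<close> satisfies \<open>\<sigma>\<^sup>p(y) = x = \<sigma>\<^sup>q(y)\<close> for \<open>p = d(\<mu>)\<close> and \<open>q = d(\<nu>)\<close>, so
  \<open>\<sigma>\<^sup>p(x) = \<sigma>\<^sup>p(\<sigma>\<^sup>q(y)) = \<sigma>\<^sup>q(\<sigma>\<^sup>p(y)) = \<sigma>\<^sup>q(x)\<close>.
\<close>

lemma periodic_at_source_if_equiv:
  assumes "\<mu> \<sim> \<nu>" shows "periodic_at (d \<mu>) (d \<nu>) (s \<mu>)"
  unfolding periodic_at_def
proof (intro ballI impI)
  fix x assume x: "x \<in> inf_paths \<Lambda>" "x (0, 0) = s \<mu>"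
  let ?y = "prepend \<Lambda> \<mu> x"
  have y: "shift (d \<mu>) ?y = x" "shift (d \<nu>) ?y = x"
    using prepend(3)[of \<mu> x] prepend(3)[of \<nu> x] equiv_prepend[OF assms x] equiv_arr[OF assms]
      equiv_s[OF assms] x by metis+
  have "shift (d \<mu>) x = shift (d \<mu>) (shift (d \<nu>) ?y)" by (simp only: y(2))
  also have "\<dots> = shift (d \<nu>) (shift (d \<mu>) ?y)" by (simp only: shift_shift add.commute)
  also have "\<dots> = shift (d \<nu>) x" by (simp only: y(1))
  finally show "shift (d \<mu>) x = shift (d \<nu>) x" .
qed

text \<open>
  The path \<open>abx = a'b'x\<close> is shifted by \<open>d(a)\<close> to \<open>bx\<close> and by \<open>d(a')\<close> to \<open>b'x\<close>; periodicity at its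
  range identifies the two.
\<close>

lemma equiv_of_periodic_at:
  assumes A: "a \<in> A" "b \<in> A" "a' \<in> A" "b' \<in> A" "s a = r b" "s a' = r b'"
    and eq: "a \<odot> b = a' \<odot> b'" and per: "periodic_at (d a) (d a') (r a)"
  shows "b \<sim> b'"
proof -
  have s: "s b = s b'" and r: "r a = r a'" using A eq by (metis src_cmp, metis rng_cmp)
  have "prepend \<Lambda> b x = prepend \<Lambda> b' x" if x: "x \<in> inf_paths \<Lambda>" "x (0, 0) = s b" for x
  proof -
    let ?z = "prepend \<Lambda> (a \<odot> b) x"
    have x': "x (0, 0) = s b'" "x (0, 0) = s (a \<odot> b)" using x(2) s A by simp_all
    have ab: "a \<odot> b \<in> A" using A by simp
    have z: "?z \<in> inf_paths \<Lambda>" "?z (0, 0) = r a"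
      using prepend(1)[OF ab x(1) x'(2)] prepend_origin[OF ab x(1) x'(2)] A by simp_all
    have y: "prepend \<Lambda> b x \<in> inf_paths \<Lambda>" "prepend \<Lambda> b x (0, 0) = s a"
      using prepend(1)[OF A(2) x] prepend_origin[OF A(2) x] A(5) by simp_all
    have y': "prepend \<Lambda> b' x \<in> inf_paths \<Lambda>" "prepend \<Lambda> b' x (0, 0) = s a'"
      using prepend(1)[OF A(4) x(1) x'(1)] prepend_origin[OF A(4) x(1) x'(1)] A(6) by simp_all
    have "shift (d a) ?z = prepend \<Lambda> b x"
      using prepend(3)[OF A(1) y] prepend_comp[OF A(1,2,5) x] by simp
    moreover have "shift (d a') ?z = prepend \<Lambda> b' x"
      using prepend(3)[OF A(3) y'] prepend_comp[OF A(3,4,6) x(1) x'(1)] eq by simp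
    moreover have "shift (d a) ?z = shift (d a') ?z"
      using per z by (simp add: periodic_at_def)
    ultimately show ?thesis by simp
  qed
  then show ?thesis using A s equivI_prepend by blast
qed

text \<open>
  For the direction from right to left, a path of degree \<open>p + q\<close> from a vertex with periodicity is
  factored in the two orders \<open>p, q\<close> and \<open>q, p\<close>; the tails are equivalent and have degrees \<open>q\<close>
  and \<open>p\<close>.
\<close>

lemma Per_iff: "z \<in> Per \<Lambda> \<longleftrightarrow>
   (\<exists>p q. \<exists>v\<in>objs \<Lambda>. periodic_at p q v \<and> z = int_vec p - int_vec q)"
proof
  assume "z \<in> Per \<Lambda>"
  then obtain \<mu> \<nu> where "\<mu> \<sim> \<nu>" "z = int_vec (d \<mu>) - int_vec (d \<nu>)"
    by (auto simp: Per_def)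
  then show "\<exists>p q. \<exists>v\<in>objs \<Lambda>. periodic_at p q v \<and> z = int_vec p - int_vec q"
    using periodic_at_source_if_equiv src_objs equiv_arr by blast
next
  assume "\<exists>p q. \<exists>v\<in>objs \<Lambda>. periodic_at p q v \<and> z = int_vec p - int_vec q"
  then obtain p q v where v: "v \<in> objs \<Lambda>" "periodic_at p q v" and z: "z = int_vec p - int_vec q"
    by blast
  obtain l where l: "l \<in> A" "r l = v" "d l = p + q" using no_sources v(1) by blast
  obtain a b where ab: "a \<in> A" "b \<in> A" "s a = r b" "d a = p" "d b = q" "l = a \<odot> b"
    using factor_ex[of l p q] l by blast
  obtain a' b' where ab': "a' \<in> A" "b' \<in> A" "s a' = r b'" "d a' = q" "d b' = p" "l = a' \<odot> b'"
    using factor_ex[of l q p] l by (metis add.commute)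
  have "r a = v" using ab l by simp
  then have "b \<sim> b'" using equiv_of_periodic_at[of a b a' b'] ab ab' v by simp
  then have "b' \<sim> b" by (rule equiv_sym)
  moreover have "z = int_vec (d b') - int_vec (d b)" using z ab(5) ab'(5) by simp
  ultimately show "z \<in> Per \<Lambda>" unfolding Per_def by blast
qed

text \<open>
  The definition of \<open>Per\<close> provides agreement of \<open>\<sigma>\<^sup>a\<close> and \<open>\<sigma>\<^sup>b\<close> for one pair of degrees \<open>(a, b)\<close>
  with \<open>a - b = p - q\<close>. Cancelling a common summand costs a step downstream: at the source
  of a path of degree \<open>b\<close> every infinite path \<open>x\<close> is some \<open>\<sigma>\<^sup>b(y)\<close>, and from \<open>p + b = a + q\<close> one gets
  \<open>\<sigma>\<^sup>p(x) = \<sigma>\<^sup>q(\<sigma>\<^sup>a(y)) = \<sigma>\<^sup>q(\<sigma>\<^sup>b(y)) = \<sigma>\<^sup>q(x)\<close>.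
\<close>

lemma periodic_at_if_Per:
  assumes "int_vec p - int_vec q \<in> Per \<Lambda>"
  shows "\<exists>v\<in>objs \<Lambda>. periodic_at p q v"
proof -
  obtain p0 q0 v where v: "v \<in> objs \<Lambda>" "periodic_at p0 q0 v"
    and eq: "int_vec p - int_vec q = int_vec p0 - int_vec q0"
    using assms by (auto simp: Per_iff)
  have "int_vec (p + q0) = int_vec (p0 + q)" using eq by (simp add: algebra_simps)
  then have eq: "p + q0 = p0 + q" by (simp only: int_vec_inject)
  obtain t where t: "t \<in> A" "r t = v" "d t = q0" using no_sources v(1) by blast
  have "shift p x = shift q x" if x: "x \<in> inf_paths \<Lambda>" "x (0, 0) = s t" for x
  proof -
    let ?y = "prepend \<Lambda> t x"
    have y: "?y \<in> inf_paths \<Lambda>" "?y (0, 0) = v" "shift q0 ?y = x"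
      using prepend(1,3)[OF t(1) x] prepend_origin[OF t(1) x] t(2,3) by simp_all
    have "shift p x = shift p (shift q0 ?y)" by (simp only: y(3))
    also have "\<dots> = shift (p0 + q) ?y" by (simp only: shift_shift eq)
    also have "\<dots> = shift q (shift p0 ?y)" by (simp add: shift_shift add.commute)
    also have "shift p0 ?y = shift q0 ?y" using v(2) y(1,2) by (simp add: periodic_at_def)
    also have "shift q (shift q0 ?y) = shift q x" by (simp only: y(3))
    finally show ?thesis .
  qed
  then show ?thesis using src_objs[OF t(1)] unfolding periodic_at_def by blast
qed

section \<open>Exchangeable degrees\<close>

text \<open>
  The condition that defines \<open>H\<^bsub>Per\<^esub>\<close>, for one pair of degrees only, but demanded at
  all vertices that can be reached from \<open>w\<close>. Thereby it passes downstream, which is needed to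
  exchange the factors of a composite path one after the other.
\<close>

definition exchangeable :: "nat^'k \<Rightarrow> nat^'k \<Rightarrow> 'a \<Rightarrow> bool" where
  "exchangeable p m w \<longleftrightarrow> (\<forall>l\<in>A. r l = w \<longrightarrow> (\<forall>g\<in>A. r g = s l \<longrightarrow> d g = p \<longrightarrow>
     (\<exists>h\<in>A. d h = m \<and> g \<sim> h)))"

lemma exchangeable_downstream:
  assumes "exchangeable p m (r l)" "l \<in> A" shows "exchangeable p m (s l)"
  unfolding exchangeable_def
proof (intro ballI impI)
  fix l' g assume "l' \<in> A" "r l' = s l" "g \<in> A" "r g = s l'" "d g = p"
  then show "\<exists>h\<in>A. d h = m \<and> g \<sim> h"
    using assms unfolding exchangeable_def by (metis cmp_closed rng_cmp src_cmp)
qed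

lemma exchangeable_zero: "exchangeable 0 0 w"
  unfolding exchangeable_def using equiv_refl by blast

lemma exchangeable_add:
  assumes "exchangeable p m w" "exchangeable p' m' w"
  shows "exchangeable (p + p') (m + m') w"
  unfolding exchangeable_def
proof (intro ballI impI)
  fix l g assume l: "l \<in> A" "r l = w" and g: "g \<in> A" "r g = s l" "d g = p + p'"
  obtain a b where ab: "a \<in> A" "b \<in> A" "s a = r b" "d a = p" "d b = p'" "g = a \<odot> b"
    using factor_ex[of g p p'] g by blast
  obtain a' where a': "a' \<in> A" "d a' = m" "a \<sim> a'"
    using assms(1) l ab g unfolding exchangeable_def by (metis rng_cmp)
  have "l \<odot> a \<in> A" "r (l \<odot> a) = w" "r b = s (l \<odot> a)" using ab g l by auto
  then obtain b' where b': "b' \<in> A" "d b' = m'" "b \<sim> b'"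
    using assms(2) ab unfolding exchangeable_def by metis
  have "s a' = r b'" using equiv_s[OF a'(3)] equiv_r[OF b'(3)] ab by simp
  then show "\<exists>h\<in>A. d h = m + m' \<and> g \<sim> h"
    using a' b' ab equiv_comp[OF a'(3) b'(3)] by (intro bexI[of _ "a' \<odot> b'"]) auto
qed

text \<open>
  Let \<open>t\<close> have degree \<open>m\<close> and start at a vertex where \<open>\<sigma>\<^sup>m\<close> and \<open>\<sigma>\<^sup>p\<close> agree. For \<open>l\<close> from \<open>s(t)\<close>,
  moving \<open>t\<close> past \<open>l\<close> gives \<open>tl = t'u\<close> with \<open>d(u) = m\<close>, and periodicity persists at \<open>r(u)\<close>. If
  \<open>g\<close> has degree \<open>p\<close> and range \<open>s(l) = s(u)\<close>, then \<open>ug = u'h\<close> with \<open>d(u') = p\<close> and \<open>d(h) = m\<close>, so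
  that the tails \<open>g\<close> and \<open>h\<close> are equivalent.
\<close>

lemma exchangeable_if_Per:
  assumes "int_vec p - int_vec m \<in> Per \<Lambda>"
  shows "\<exists>w\<in>objs \<Lambda>. exchangeable p m w"
proof -
  obtain v where v: "v \<in> objs \<Lambda>" "periodic_at m p v"
    using periodic_at_if_Per[OF assms] periodic_at_sym by blast
  obtain t where t: "t \<in> A" "r t = v" "d t = m" using no_sources v(1) by blast
  have "\<exists>h\<in>A. d h = m \<and> g \<sim> h"
    if l: "l \<in> A" "r l = s t" and g: "g \<in> A" "r g = s l" "d g = p" for l g
  proof -
    obtain t' u where tu: "t' \<in> A" "u \<in> A" "s t' = r u" "d u = m" "t \<odot> l = t' \<odot> u"
      using factor_ex[of "t \<odot> l" "d l" m] t l by (metis cmp_closed d_comp add.commute)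
    have "r t' = v" "s u = s l" using tu t l by (metis rng_cmp, metis src_cmp)
    then have per: "periodic_at m p (r u)"
      using periodic_at_downstream[of m p t'] v tu by simp
    obtain u' h where "u' \<in> A" "h \<in> A" "s u' = r h" "d u' = p" "d h = m" "u \<odot> g = u' \<odot> h"
      using factor_ex[of "u \<odot> g" p m] tu g \<open>s u = s l\<close> by (metis cmp_closed d_comp add.commute)
    then show ?thesis
      using equiv_of_periodic_at[of u g u' h] tu g per \<open>s u = s l\<close> by auto
  qed
  then show ?thesis using src_objs[OF t(1)] unfolding exchangeable_def by blast
qed

end

locale maximal_tail_graph = row_finite_higher_rank_graph \<Lambda>
  for \<Lambda> :: "('a, nat^'k::finite) pgraph" +
  assumes maximal_tail: "maximal_tail \<Lambda> (objs \<Lambda>)"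
begin

lemma common_descendant:
  assumes "v \<in> objs \<Lambda>" "w \<in> objs \<Lambda>"
  obtains f g where "f \<in> A" "g \<in> A" "r f = v" "r g = w" "s f = s g"
  using maximal_tail assms unfolding maximal_tail_def paths_between_def by blast

lemma objs_nonempty: "objs \<Lambda> \<noteq> {}"
  using maximal_tail by (simp add: maximal_tail_def)

section \<open>The periodicity group\<close>

lemma Per_zero: "0 \<in> Per \<Lambda>"
  unfolding Per_iff using objs_nonempty periodic_at_zero by force

lemma Per_uminus: "z \<in> Per \<Lambda> \<Longrightarrow> - z \<in> Per \<Lambda>"
  unfolding Per_iff using periodic_at_sym by (metis minus_diff_eq)

lemma Per_add:
  assumes "y \<in> Per \<Lambda>" "z \<in> Per \<Lambda>" shows "y + z \<in> Per \<Lambda>"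
proof -
  obtain p q v p' q' v' where y: "v \<in> objs \<Lambda>" "periodic_at p q v" "y = int_vec p - int_vec q"
    and z: "v' \<in> objs \<Lambda>" "periodic_at p' q' v'" "z = int_vec p' - int_vec q'"
    using assms unfolding Per_iff by blast
  obtain f g where fg: "f \<in> A" "g \<in> A" "r f = v" "r g = v'" "s f = s g"
    using common_descendant y(1) z(1) by blast
  have "periodic_at (p + p') (q + q') (s f)"
    using periodic_at_add periodic_at_downstream[of p q f] periodic_at_downstream[of p' q' g]
      y z fg by simp
  moreover have "y + z = int_vec (p + p') - int_vec (q + q')" using y z by simp
  ultimately show ?thesis unfolding Per_iff using src_objs[OF fg(1)] by blast
qed

lemma Per_diff: "\<lbrakk>y \<in> Per \<Lambda>; z \<in> Per \<Lambda>\<rbrakk> \<Longrightarrow> y - z \<in> Per \<Lambda>"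
  using Per_add[of y "- z"] Per_uminus by simp

lemma subgroup_Per: "subgroup (Per \<Lambda>) plus_monoid"
proof (rule group.subgroupI[OF group_plus_monoid])
  show "inv\<^bsub>plus_monoid\<^esub> a \<in> Per \<Lambda>" if "a \<in> Per \<Lambda>" for a
    using that Per_uminus group.inv_equality[OF group_plus_monoid, of "- a" a] by simp
qed (use Per_zero Per_add in auto)

section \<open>The hereditary set\<close>

lemma exchangeable_finite:
  assumes "finite M" "M \<subseteq> {(p, m). int_vec p - int_vec m \<in> Per \<Lambda>}"
  shows "\<exists>w\<in>objs \<Lambda>. \<forall>(p, m)\<in>M. exchangeable p m w"
  using assms
proof (induction M)
  case empty
  then show ?case using objs_nonempty by auto
next
  case (insert a M)
  then obtain w where w: "w \<in> objs \<Lambda>" "\<And>p m. (p, m) \<in> M \<Longrightarrow> exchangeable p m w" by auto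
  obtain w' where w': "w' \<in> objs \<Lambda>" "exchangeable (fst a) (snd a) w'"
    using insert.prems exchangeable_if_Per[of "fst a" "snd a"] by (auto simp: split_beta)
  obtain f g where fg: "f \<in> A" "g \<in> A" "r f = w" "r g = w'" "s f = s g"
    using common_descendant w(1) w'(1) by blast
  have "exchangeable (fst a) (snd a) (s f)"
    using exchangeable_downstream[of "fst a" "snd a" g] w'(2) fg by simp
  moreover have "exchangeable p m (s f)" if "(p, m) \<in> M" for p m
    using exchangeable_downstream[of p m f] w(2)[OF that] fg by simp
  ultimately show ?case
    using src_objs[OF fg(1)] by (intro bexI[of _ "s f"]) auto
qed

abbreviation "H \<equiv> H_Per \<Lambda>"

lemma H_Per_iff: "v \<in> H \<longleftrightarrow> v \<in> objs \<Lambda> \<and> (\<forall>l\<in>A. \<forall>m. r l = v \<longrightarrow>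
   int_vec (d l) - int_vec m \<in> Per \<Lambda> \<longrightarrow> (\<exists>\<mu>\<in>A. d \<mu> = m \<and> l \<sim> \<mu>))"
proof -
  have "(\<exists>\<mu>\<in>paths_of_degree \<Lambda> v m. l \<sim> \<mu>) \<longleftrightarrow> (\<exists>\<mu>\<in>A. d \<mu> = m \<and> l \<sim> \<mu>)" if "r l = v" for l m
    unfolding paths_of_degree_def using equiv_r[of l] that by auto
  then show ?thesis unfolding H_Per_def mem_Collect_eq by blast
qed

lemma H_Per_objs: "v \<in> H \<Longrightarrow> v \<in> objs \<Lambda>"
  unfolding H_Per_iff by blast

lemma H_Per_exchange:
  assumes "r l \<in> H" "l \<in> A" "int_vec (d l) - int_vec m \<in> Per \<Lambda>"
  obtains \<mu> where "\<mu> \<in> A" "d \<mu> = m" "l \<sim> \<mu>"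
  using assms unfolding H_Per_iff by blast

text \<open>
  At a common descendant of the vertices where the finitely many generating pairs are exchangeable,
  all of them are, and by additivity all pairs with difference in \<open>Per(\<Lambda>)\<close> are.
\<close>

lemma H_Per_nonempty: "H \<noteq> {}"
proof -
  obtain M where M: "finite M" "M \<subseteq> {(p, m). int_vec p - int_vec m \<in> Per \<Lambda>}"
    "\<And>Q. \<lbrakk>Q 0 0; \<And>a b. (a, b) \<in> M \<Longrightarrow> Q a b;
           \<And>a b c d. \<lbrakk>Q a b; Q c d\<rbrakk> \<Longrightarrow> Q (a + c) (b + d)\<rbrakk>
      \<Longrightarrow> \<forall>(a, b)\<in>{(p, m). int_vec p - int_vec m \<in> Per \<Lambda>}. Q a b"
  proof (rule finite_generators_of_saturated_pairs[of "{(p, m). int_vec p - int_vec m \<in> Per \<Lambda>}"])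
    fix a b c d :: "nat^'k"
    assume "(a, b) \<in> {(p, m). int_vec p - int_vec m \<in> Per \<Lambda>}"
      "(a + c, b + d) \<in> {(p, m). int_vec p - int_vec m \<in> Per \<Lambda>}"
    then show "(c, d) \<in> {(p, m). int_vec p - int_vec m \<in> Per \<Lambda>}"
      using Per_diff[of "int_vec (a + c) - int_vec (b + d)" "int_vec a - int_vec b"]
      by (simp add: algebra_simps)
  qed blast
  obtain w where w: "w \<in> objs \<Lambda>" "\<forall>(p, m)\<in>M. exchangeable p m w"
    using exchangeable_finite[OF M(1,2)] by blast
  have ex: "exchangeable p m w" if "int_vec p - int_vec m \<in> Per \<Lambda>" for p m
    using M(3)[of "\<lambda>p m. exchangeable p m w"] w(2) exchangeable_zero exchangeable_add that by auto
  have "\<exists>\<mu>\<in>A. d \<mu> = m \<and> l \<sim> \<mu>"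
    if "l \<in> A" "r l = w" "int_vec (d l) - int_vec m \<in> Per \<Lambda>" for l m
    using ex[OF that(3)] that w(1) unfolding exchangeable_def by (metis obj_arr obj_r obj_s)
  then have "w \<in> H" unfolding H_Per_iff using w(1) by blast
  then show ?thesis by blast
qed

text \<open>
  For \<open>b\<close> from \<open>s(l)\<close>, exchange \<open>lb\<close> against a path of degree \<open>d(l) + m\<close>. Its prefix of degree
  \<open>d(l)\<close> must be \<open>l\<close>, as both begin the same infinite path, and \<open>l\<close> can be cancelled.
\<close>

lemma H_Per_downstream:
  assumes l: "l \<in> A" "r l \<in> H" shows "s l \<in> H"
proof -
  have "\<exists>\<mu>\<in>A. d \<mu> = m \<and> b \<sim> \<mu>"
    if b: "b \<in> A" "r b = s l" "int_vec (d b) - int_vec m \<in> Per \<Lambda>" for b m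
  proof -
    obtain g where g: "g \<in> A" "d g = d l + m" "l \<odot> b \<sim> g"
      using H_Per_exchange[of "l \<odot> b" "d l + m"] l b by auto
    obtain l' b' where lb: "l' \<in> A" "b' \<in> A" "s l' = r b'" "d l' = d l" "d b' = m" "g = l' \<odot> b'"
      using factor_ex[OF g(1,2)] by metis
    obtain x where x: "x \<in> inf_paths \<Lambda>" "x (0, 0) = s b"
      using ex_inf_path[OF src_objs] b by blast
    have s: "s b' = s b" using equiv_s[OF g(3)] lb l b by simp
    have lb_A: "l \<odot> b \<in> A" "s l = r b" and x': "x (0, 0) = s b'" "x (0, 0) = s (l \<odot> b)"
      using l b x(2) s by simp_all
    have "prepend \<Lambda> l (prepend \<Lambda> b x) = prepend \<Lambda> l' (prepend \<Lambda> b' x)"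
      using equiv_prepend[OF g(3) x(1) x'(2)] prepend_comp[OF l(1) b(1) lb_A(2) x]
        prepend_comp[OF lb(1-3) x(1) x'(1)] lb(6) by simp
    moreover have "prepend \<Lambda> l (prepend \<Lambda> b x) (0, d l) = l"
      using prepend(2)[OF l(1) prepend(1)[OF b(1) x]] prepend_origin[OF b(1) x] lb_A(2) by simp
    moreover have "prepend \<Lambda> l' (prepend \<Lambda> b' x) (0, d l') = l'"
      using prepend(2)[OF lb(1) prepend(1)[OF lb(2) x(1) x'(1)]]
        prepend_origin[OF lb(2) x(1) x'(1)] lb(3) by simp
    ultimately have "l' = l" using lb(4) by simp
    then have "b \<sim> b'" using equiv_cancel_left[of l b b'] l b lb g(3) by simp
    then show ?thesis using lb by blast
  qed
  then show ?thesis using src_objs[OF l(1)] unfolding H_Per_iff by blast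
qed

lemma hereditary_H_Per: "hereditary \<Lambda> H"
  unfolding hereditary_def using H_Per_downstream H_Per_objs by auto

text \<open>
  An equivalent \<open>\<mu>\<close> of degree \<open>q\<close> for \<open>x(0, p)\<close> gives \<open>x = x(0, p) \<sigma>\<^sup>p(x) = \<mu> \<sigma>\<^sup>p(x)\<close>, whose shift
  by \<open>q\<close> is \<open>\<sigma>\<^sup>p(x)\<close>.
\<close>

lemma shift_eq_on_H_Per:
  assumes "int_vec p - int_vec q \<in> Per \<Lambda>" "x \<in> inf_paths \<Lambda>" "x (0, 0) \<in> H"
  shows "shift p x = shift q x"
proof -
  obtain \<mu> where \<mu>: "\<mu> \<in> A" "d \<mu> = q" "x (0, p) \<sim> \<mu>"
    using H_Per_exchange[of "x (0, p)" q] assms inf_path_init[OF assms(2), of p] by auto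
  have y: "shift p x \<in> inf_paths \<Lambda>" "shift p x (0, 0) = s (x (0, p))"
    using shift_in_inf_paths[OF assms(2)] shift_origin[OF assms(2)] by simp_all
  have "prepend \<Lambda> \<mu> (shift p x) = x"
    using equiv_prepend[OF \<mu>(3) y] prepend_init_shift[OF assms(2), of p] by simp
  moreover have "shift (d \<mu>) (prepend \<Lambda> \<mu> (shift p x)) = shift p x"
    using prepend(3)[OF \<mu>(1) y(1)] y(2) equiv_s[OF \<mu>(3)] by simp
  ultimately show ?thesis using \<mu>(2) by simp
qed

lemma unique_equiv_of_degree:
  assumes "l \<in> A" "r l \<in> H" "int_vec (d l) - int_vec m \<in> Per \<Lambda>"
  shows "\<exists>!\<mu>. \<mu> \<in> paths_of_degree \<Lambda> (r l) m \<and> \<mu> \<sim> l"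
proof -
  obtain \<mu> where \<mu>: "\<mu> \<in> A" "d \<mu> = m" "l \<sim> \<mu>" using H_Per_exchange assms by blast
  have "\<nu> = \<mu>" if "\<nu> \<sim> l" "d \<nu> = m" for \<nu>
    using equiv_same_degree[OF equiv_trans[OF that(1) \<mu>(3)]] that \<mu> by simp
  moreover have "\<mu> \<in> paths_of_degree \<Lambda> (r l) m \<and> \<mu> \<sim> l"
    unfolding paths_of_degree_def using \<mu>(1,2) equiv_sym[OF \<mu>(3)] equiv_r[OF \<mu>(3)] by simp
  ultimately show ?thesis unfolding paths_of_degree_def by blast
qed

end

section \<open>Restriction and transport of graphs\<close>

lemma P_graph_restrict_range:
  assumes "P_graph P \<Lambda>" and her: "hereditary \<Lambda> H"
  shows "P_graph P (restrict_range \<Lambda> H)"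
proof -
  interpret P_graph P \<Lambda> by fact
  let ?R = "restrict_range \<Lambda> H"
  have sel: "arr ?R = {l \<in> arr \<Lambda>. rng \<Lambda> l \<in> H}" "rng ?R = rng \<Lambda>" "src ?R = src \<Lambda>"
    "cmp ?R = cmp \<Lambda>" "deg ?R = deg \<Lambda>"
    by (simp_all add: restrict_range_def)
  have src_H: "src \<Lambda> l \<in> H" if "l \<in> arr \<Lambda>" "rng \<Lambda> l \<in> H" for l
    using her that by (auto simp: hereditary_def)
  have objs: "objs ?R = objs \<Lambda> \<inter> H"
    by (auto simp: objs_def sel)
  show ?thesis
  proof (intro P_graph.intro P_graph_axioms.intro)
    show "fg_cancellative_comm_monoid P" by unfold_locales
    show "small_category ?R"
    proof
      show "rng ?R f \<in> objs ?R" if "f \<in> arr ?R" for f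
        using that rng_objs unfolding objs sel by blast
      show "src ?R f \<in> objs ?R" if "f \<in> arr ?R" for f
        using that src_objs src_H unfolding objs sel by blast
      show "cmp ?R f g \<in> arr ?R" if "f \<in> arr ?R" "g \<in> arr ?R" "src ?R f = rng ?R g" for f g
        using that cmp_closed rng_cmp unfolding sel by auto
    qed (auto simp: sel rng_cmp src_cmp id_left id_right cmp_assoc)
    show "countable (arr ?R)"
      using countable_arr by (rule countable_subset[rotated]) (auto simp: sel)
    show "\<exists>!(\<eta>, \<zeta>). \<eta> \<in> arr ?R \<and> \<zeta> \<in> arr ?R \<and> src ?R \<eta> = rng ?R \<zeta>
        \<and> deg ?R \<eta> = p \<and> deg ?R \<zeta> = q \<and> \<xi> = cmp ?R \<eta> \<zeta>"
      if "\<xi> \<in> arr ?R" and pq: "p \<in> carrier P" "q \<in> carrier P"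
        and "deg ?R \<xi> = p \<otimes>\<^bsub>P\<^esub> q" for \<xi> p q
    proof -
      have \<xi>: "\<xi> \<in> arr \<Lambda>" "rng \<Lambda> \<xi> \<in> H" "deg \<Lambda> \<xi> = p \<otimes>\<^bsub>P\<^esub> q" using that unfolding sel by auto
      obtain \<eta> \<zeta> where ex: "\<eta> \<in> arr \<Lambda> \<and> \<zeta> \<in> arr \<Lambda> \<and> src \<Lambda> \<eta> = rng \<Lambda> \<zeta> \<and> deg \<Lambda> \<eta> = p
          \<and> deg \<Lambda> \<zeta> = q \<and> \<xi> = cmp \<Lambda> \<eta> \<zeta>"
        and un: "\<forall>\<eta>' \<zeta>'. \<eta>' \<in> arr \<Lambda> \<and> \<zeta>' \<in> arr \<Lambda> \<and> src \<Lambda> \<eta>' = rng \<Lambda> \<zeta>' \<and> deg \<Lambda> \<eta>' = p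
          \<and> deg \<Lambda> \<zeta>' = q \<and> \<xi> = cmp \<Lambda> \<eta>' \<zeta>' \<longrightarrow> \<eta>' = \<eta> \<and> \<zeta>' = \<zeta>"
        using factorisation[OF \<xi>(1) pq \<xi>(3)] by (rule ex1_pairE)
      have "rng \<Lambda> \<eta> \<in> H" using ex \<xi>(2) rng_cmp by metis
      then have "rng \<Lambda> \<zeta> \<in> H" using ex src_H by metis
      show ?thesis
        unfolding sel
      proof (rule ex1_pairI)
        show "\<eta> \<in> {l \<in> arr \<Lambda>. rng \<Lambda> l \<in> H} \<and> \<zeta> \<in> {l \<in> arr \<Lambda>. rng \<Lambda> l \<in> H} \<and> src \<Lambda> \<eta> = rng \<Lambda> \<zeta>
            \<and> deg \<Lambda> \<eta> = p \<and> deg \<Lambda> \<zeta> = q \<and> \<xi> = cmp \<Lambda> \<eta> \<zeta>"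
          using ex \<open>rng \<Lambda> \<eta> \<in> H\<close> \<open>rng \<Lambda> \<zeta> \<in> H\<close> by blast
      qed (use un in blast)
    qed
  qed (auto simp: sel objs deg_closed deg_objs deg_cmp)
qed

text \<open>
  A degree-preserving functor that is bijective on morphisms carries the structure of a graph to its
  target. So the pullback need not be shown to be a graph on its own: the isomorphism
  with \<open>H\<^bsub>Per\<^esub>\<Lambda>\<close> yields it.
\<close>

lemma P_graph_transport:
  assumes "P_graph P \<Gamma>" and deg_fun: "degree_functor \<Gamma> \<Delta> f" and bij: "bij_betw f (arr \<Gamma>) (arr \<Delta>)"
  shows "P_graph P \<Delta>" and "P_graph_iso P \<Gamma> \<Delta> f"
proof -
  interpret P_graph P \<Gamma> by fact
  have f: "f \<xi> \<in> arr \<Delta>" "rng \<Delta> (f \<xi>) = f (rng \<Gamma> \<xi>)" "src \<Delta> (f \<xi>) = f (src \<Gamma> \<xi>)"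
    "deg \<Delta> (f \<xi>) = deg \<Gamma> \<xi>" if "\<xi> \<in> arr \<Gamma>" for \<xi>
    using deg_fun that by (auto simp: degree_functor_def)
  have f_cmp: "cmp \<Delta> (f \<eta>) (f \<zeta>) = f (cmp \<Gamma> \<eta> \<zeta>)"
    if "\<eta> \<in> arr \<Gamma>" "\<zeta> \<in> arr \<Gamma>" "src \<Gamma> \<eta> = rng \<Gamma> \<zeta>" for \<eta> \<zeta>
    using deg_fun that by (simp add: degree_functor_def)
  have inj: "f a = f b \<longleftrightarrow> a = b" if "a \<in> arr \<Gamma>" "b \<in> arr \<Gamma>" for a b
    using bij that by (auto simp: bij_betw_def inj_on_def)
  have arr_\<Delta>: "arr \<Delta> = f ` arr \<Gamma>" using bij by (simp add: bij_betw_def)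
  have rs: "rng \<Gamma> \<xi> \<in> arr \<Gamma>" "src \<Gamma> \<xi> \<in> arr \<Gamma>" "src \<Gamma> (rng \<Gamma> \<xi>) = rng \<Gamma> \<xi>"
    "rng \<Gamma> (src \<Gamma> \<xi>) = src \<Gamma> \<xi>" if "\<xi> \<in> arr \<Gamma>" for \<xi>
    using rng_objs[OF that] src_objs[OF that] by (simp_all add: objs_def)
  have objs_\<Delta>: "objs \<Delta> = f ` objs \<Gamma>"
    unfolding objs_def arr_\<Delta> by (auto simp: f inj rs)
  have comp: "src \<Delta> (f \<eta>) = rng \<Delta> (f \<zeta>) \<longleftrightarrow> src \<Gamma> \<eta> = rng \<Gamma> \<zeta>"
    if "\<eta> \<in> arr \<Gamma>" "\<zeta> \<in> arr \<Gamma>" for \<eta> \<zeta>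
    using that by (simp add: f inj rs)
  show graph: "P_graph P \<Delta>"
  proof (intro P_graph.intro P_graph_axioms.intro)
    show "fg_cancellative_comm_monoid P" by unfold_locales
    show "small_category \<Delta>"
      unfolding small_category_def arr_\<Delta> objs_\<Delta>
      by (auto simp: inj f f_cmp rng_objs src_objs cmp_closed rng_cmp src_cmp id_left id_right
          cmp_assoc rs)
    show "countable (arr \<Delta>)" unfolding arr_\<Delta> using countable_arr by (rule countable_image)
    show "deg \<Delta> \<xi> \<in> carrier P" if "\<xi> \<in> arr \<Delta>" for \<xi>
      using that by (auto simp: arr_\<Delta> f deg_closed)
    show "deg \<Delta> v = \<one>\<^bsub>P\<^esub>" if v: "v \<in> objs \<Delta>" for v
    proof -
      obtain w where w: "w \<in> objs \<Gamma>" "v = f w" using v unfolding objs_\<Delta> by blast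
      then have "w \<in> arr \<Gamma>" by (simp add: objs_def)
      then show ?thesis using w by (simp add: f deg_objs)
    qed
    show "deg \<Delta> (cmp \<Delta> \<eta> \<zeta>) = deg \<Delta> \<eta> \<otimes>\<^bsub>P\<^esub> deg \<Delta> \<zeta>"
      if "\<eta> \<in> arr \<Delta>" "\<zeta> \<in> arr \<Delta>" "src \<Delta> \<eta> = rng \<Delta> \<zeta>" for \<eta> \<zeta>
      using that by (auto simp: arr_\<Delta> inj rs f f_cmp cmp_closed deg_cmp)
    show "\<exists>!(\<eta>, \<zeta>). \<eta> \<in> arr \<Delta> \<and> \<zeta> \<in> arr \<Delta> \<and> src \<Delta> \<eta> = rng \<Delta> \<zeta>
        \<and> deg \<Delta> \<eta> = p \<and> deg \<Delta> \<zeta> = q \<and> \<xi> = cmp \<Delta> \<eta> \<zeta>"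
      if \<xi>: "\<xi> \<in> arr \<Delta>" and pq: "p \<in> carrier P" "q \<in> carrier P" and "deg \<Delta> \<xi> = p \<otimes>\<^bsub>P\<^esub> q" for \<xi> p q
    proof -
      obtain x where x: "x \<in> arr \<Gamma>" "\<xi> = f x" using \<xi> by (auto simp: arr_\<Delta>)
      then have dx: "deg \<Gamma> x = p \<otimes>\<^bsub>P\<^esub> q" using that(4) f by simp
      obtain \<eta> \<zeta> where ex: "\<eta> \<in> arr \<Gamma> \<and> \<zeta> \<in> arr \<Gamma> \<and> src \<Gamma> \<eta> = rng \<Gamma> \<zeta> \<and> deg \<Gamma> \<eta> = p
          \<and> deg \<Gamma> \<zeta> = q \<and> x = cmp \<Gamma> \<eta> \<zeta>"
        and un: "\<forall>\<eta>' \<zeta>'. \<eta>' \<in> arr \<Gamma> \<and> \<zeta>' \<in> arr \<Gamma> \<and> src \<Gamma> \<eta>' = rng \<Gamma> \<zeta>' \<and> deg \<Gamma> \<eta>' = p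
          \<and> deg \<Gamma> \<zeta>' = q \<and> x = cmp \<Gamma> \<eta>' \<zeta>' \<longrightarrow> \<eta>' = \<eta> \<and> \<zeta>' = \<zeta>"
        using factorisation[OF x(1) pq dx] by (rule ex1_pairE)
      show ?thesis
      proof (rule ex1_pairI)
        show "f \<eta> \<in> arr \<Delta> \<and> f \<zeta> \<in> arr \<Delta> \<and> src \<Delta> (f \<eta>) = rng \<Delta> (f \<zeta>)
            \<and> deg \<Delta> (f \<eta>) = p \<and> deg \<Delta> (f \<zeta>) = q \<and> \<xi> = cmp \<Delta> (f \<eta>) (f \<zeta>)"
          using ex x(2) by (simp add: f f_cmp)
      next
        fix \<eta>' \<zeta>'
        assume a: "\<eta>' \<in> arr \<Delta> \<and> \<zeta>' \<in> arr \<Delta> \<and> src \<Delta> \<eta>' = rng \<Delta> \<zeta>'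
            \<and> deg \<Delta> \<eta>' = p \<and> deg \<Delta> \<zeta>' = q \<and> \<xi> = cmp \<Delta> \<eta>' \<zeta>'"
        then obtain a b where ab: "a \<in> arr \<Gamma>" "\<eta>' = f a" "b \<in> arr \<Gamma>" "\<zeta>' = f b"
          by (auto simp: arr_\<Delta>)
        have "src \<Gamma> a = rng \<Gamma> b" using a ab comp by metis
        moreover have "f x = f (cmp \<Gamma> a b)" using a ab x(2) f_cmp \<open>src \<Gamma> a = rng \<Gamma> b\<close> by metis
        ultimately have "x = cmp \<Gamma> a b" using inj x(1) ab cmp_closed by metis
        then have "a = \<eta> \<and> b = \<zeta>"
          using un a ab f(4) \<open>src \<Gamma> a = rng \<Gamma> b\<close> by metis
        then show "\<eta>' = f \<eta> \<and> \<zeta>' = f \<zeta>" using ab by simp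
      qed
    qed
  qed
  define g where "g = inv_into (arr \<Gamma>) f"
  have gf: "g (f \<xi>) = \<xi>" if "\<xi> \<in> arr \<Gamma>" for \<xi>
    using bij that by (simp add: g_def bij_betw_def)
  have "degree_functor \<Delta> \<Gamma> g"
    unfolding degree_functor_def arr_\<Delta> by (auto simp: gf f rs inj f_cmp cmp_closed)
  moreover have "\<forall>\<eta>\<in>arr \<Delta>. f (g \<eta>) = \<eta>" by (auto simp: arr_\<Delta> gf)
  ultimately show "P_graph_iso P \<Gamma> \<Delta> f"
    unfolding P_graph_iso_def using graph deg_fun gf \<open>P_graph P \<Gamma>\<close> by blast
qed

section \<open>The quotient graph\<close>

lemma the_elem_image_const:
  assumes "X \<noteq> {}" "\<And>x. x \<in> X \<Longrightarrow> f x = c" shows "the_elem (f ` X) = c"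
proof -
  have "f ` X = {c}" using assms by auto
  then show ?thesis by simp
qed

context maximal_tail_graph
begin

abbreviation "cls \<equiv> path_class \<Lambda>"
abbreviation "Q \<equiv> quotient_graph \<Lambda> H"
abbreviation "M \<equiv> q_monoid \<Lambda>"
abbreviation "q n \<equiv> q_Per \<Lambda> (int_vec n)"

lemma q_Per_eq_image: "q_Per \<Lambda> z = (\<lambda>h. h + z) ` Per \<Lambda>"
  by (auto simp: q_Per_def r_coset_def)

lemma q_Per_eq_iff: "q_Per \<Lambda> y = q_Per \<Lambda> z \<longleftrightarrow> y - z \<in> Per \<Lambda>"
proof
  assume "q_Per \<Lambda> y = q_Per \<Lambda> z"
  then have "y \<in> (\<lambda>h. h + z) ` Per \<Lambda>" using Per_zero by (force simp: q_Per_eq_image)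
  then show "y - z \<in> Per \<Lambda>" by auto
next
  assume yz: "y - z \<in> Per \<Lambda>"
  have "h + y \<in> q_Per \<Lambda> z" if "h \<in> Per \<Lambda>" for h
    using Per_add[OF that yz] by (force simp: q_Per_eq_image intro: image_eqI[of _ _ "h + (y - z)"])
  moreover have "h + z \<in> q_Per \<Lambda> y" if "h \<in> Per \<Lambda>" for h
    using Per_diff[OF that yz] by (force simp: q_Per_eq_image intro: image_eqI[of _ _ "h - (y - z)"])
  ultimately show "q_Per \<Lambda> y = q_Per \<Lambda> z" by (auto simp: q_Per_eq_image[of y] q_Per_eq_image[of z])
qed

lemma carrier_M: "carrier M = range q"
  by (auto simp: q_monoid_def)

lemma one_M: "\<one>\<^bsub>M\<^esub> = q 0"
  by (simp add: q_monoid_def FactGroup_def q_Per_eq_image)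

lemma mult_M: "q m \<otimes>\<^bsub>M\<^esub> q n = q (m + n)"
proof -
  have "q m \<otimes>\<^bsub>M\<^esub> q n = {(h + int_vec m) + (k + int_vec n) | h k. h \<in> Per \<Lambda> \<and> k \<in> Per \<Lambda>}"
    by (auto simp: q_monoid_def FactGroup_def set_mult_def q_Per_eq_image)
  also have "\<dots> = q (m + n)"
  proof (intro equalityI subsetI)
    fix z assume "z \<in> {(h + int_vec m) + (k + int_vec n) | h k. h \<in> Per \<Lambda> \<and> k \<in> Per \<Lambda>}"
    then obtain h k where "h \<in> Per \<Lambda>" "k \<in> Per \<Lambda>" "z = (h + int_vec m) + (k + int_vec n)" by blast
    then have "h + k \<in> Per \<Lambda>" "z = (h + k) + int_vec (m + n)"
      using Per_add by (auto simp: algebra_simps)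
    then show "z \<in> q (m + n)" unfolding q_Per_eq_image by blast
  next
    fix z assume "z \<in> q (m + n)"
    then obtain h where "h \<in> Per \<Lambda>" "z = h + int_vec (m + n)" unfolding q_Per_eq_image by blast
    then have "h \<in> Per \<Lambda>" "0 \<in> Per \<Lambda>" "z = (h + int_vec m) + (0 + int_vec n)"
      using Per_zero by (auto simp: algebra_simps)
    then show "z \<in> {(h + int_vec m) + (k + int_vec n) | h k. h \<in> Per \<Lambda> \<and> k \<in> Per \<Lambda>}" by blast
  qed
  finally show ?thesis .
qed

text \<open>The images of the unit vectors generate; the induction removes one unit vector at a time.\<close>

lemma q_in_generated_submonoid:
  assumes K: "submonoid K M" and gen: "\<And>i. q (axis i 1) \<in> K"
  shows "q n \<in> K"
proof (induction "\<Sum>i\<in>UNIV. n $ i" arbitrary: n rule: less_induct)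
  case less
  show ?case
  proof (cases "n = 0")
    case True
    then show ?thesis using submonoid.one_closed[OF K] one_M by simp
  next
    case False
    then obtain i where i: "n $ i \<noteq> 0" by (auto simp: vec_eq_iff)
    define n' where "n' = (\<chi> j. if j = i then n $ i - 1 else n $ j)"
    have n: "n = n' + axis i 1" using i by (auto simp: n'_def vec_eq_iff axis_def)
    have "(\<Sum>j\<in>UNIV. n' $ j) < (\<Sum>j\<in>UNIV. n $ j)"
      using i by (intro sum_strict_mono2[of UNIV UNIV] sum_strict_mono_ex1) (auto simp: n'_def)
    then have "q n' \<otimes>\<^bsub>M\<^esub> q (axis i 1) \<in> K" using less gen submonoid.m_closed[OF K] by blast
    then show ?thesis using n by (simp only: mult_M)
  qed
qed

lemma fg_cancellative_comm_monoid_M: "fg_cancellative_comm_monoid M"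
proof (intro fg_cancellative_comm_monoid.intro fg_cancellative_comm_monoid_axioms.intro)
  show "comm_monoid M"
    by (rule comm_monoidI)
      (auto simp: carrier_M one_M mult_M ac_simps simp del: int_vec_add int_vec_zero)
  show "x = y"
    if xyt: "x \<in> carrier M" "y \<in> carrier M" "t \<in> carrier M" "x \<otimes>\<^bsub>M\<^esub> t = y \<otimes>\<^bsub>M\<^esub> t" for x y t
  proof -
    obtain m n k where "x = q m" "y = q n" "t = q k" using xyt(1-3) unfolding carrier_M by blast
    moreover from this have "int_vec (m + k) - int_vec (n + k) \<in> Per \<Lambda>"
      using xyt(4) by (simp only: mult_M q_Per_eq_iff)
    ultimately show ?thesis by (simp add: q_Per_eq_iff)
  qed
  have "K = carrier M" if "submonoid K M" "range (\<lambda>i. q (axis i 1)) \<subseteq> K" for K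
    using q_in_generated_submonoid[OF that(1)] that(2) submonoid.subset[OF that(1)]
    unfolding carrier_M by blast
  then show "finitely_generated_monoid M"
    unfolding finitely_generated_monoid_def
    by (intro exI[of _ "range (\<lambda>i. q (axis i 1))"]) (auto simp: carrier_M)
qed

lemma cls_eq_iff: "\<lbrakk>l \<in> A; m \<in> A\<rbrakk> \<Longrightarrow> cls l = cls m \<longleftrightarrow> l \<sim> m"
  unfolding path_class_def using eq_equiv_class_iff[OF equiv_path_equiv] by blast

lemma mem_cls_iff: "m \<in> cls l \<longleftrightarrow> l \<sim> m"
  by (simp add: path_class_def)

lemma cls_nonempty: "l \<in> A \<Longrightarrow> cls l \<noteq> {}"
  using mem_cls_iff equiv_refl by blast

lemma cls_obj_eq_iff:
  assumes "v \<in> objs \<Lambda>" "w \<in> objs \<Lambda>" shows "cls v = cls w \<longleftrightarrow> v = w"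
  using cls_eq_iff[of v w] equiv_same_degree[of v w] assms by (auto simp: obj_arr obj_d)

lemma arr_Q: "arr Q = cls ` {l \<in> A. r l \<in> H}"
  by (auto simp: quotient_graph_def quotient_def path_class_def)

lemma rng_Q: "l \<in> A \<Longrightarrow> rng Q (cls l) = cls (r l)"
  unfolding quotient_graph_def
  by simp (rule the_elem_image_const, auto simp: cls_nonempty mem_cls_iff dest: equiv_r)

lemma src_Q: "l \<in> A \<Longrightarrow> src Q (cls l) = cls (s l)"
  unfolding quotient_graph_def
  by simp (rule the_elem_image_const, auto simp: cls_nonempty mem_cls_iff dest: equiv_s)

lemma deg_Q:
  assumes "l \<in> A" shows "deg Q (cls l) = q (d l)"
  unfolding quotient_graph_def
proof (simp, rule the_elem_image_const)
  fix x assume "x \<in> cls l"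
  then have "x \<sim> l" using mem_cls_iff equiv_sym by blast
  then show "q (d x) = q (d l)" unfolding q_Per_eq_iff Per_def by blast
qed (use assms cls_nonempty in auto)

lemma cmp_Q:
  assumes "l \<in> A" "m \<in> A" "s l = r m" shows "cmp Q (cls l) (cls m) = cls (l \<odot> m)"
  unfolding quotient_graph_def
proof (simp, rule the_elem_image_const)
  show "cls l \<times> cls m \<noteq> {}" using assms cls_nonempty by blast
  fix x assume "x \<in> cls l \<times> cls m"
  then obtain l' m' where x: "x = (l', m')" "l \<sim> l'" "m \<sim> m'" by (auto simp: mem_cls_iff)
  have "l \<odot> m \<sim> l' \<odot> m'" using equiv_comp x assms(3) by blast
  then have "cls (l \<odot> m) = cls (l' \<odot> m')" using cls_eq_iff equiv_arr by blast
  then show "(case x of (l, m) \<Rightarrow> cls (l \<odot> m)) = cls (l \<odot> m)" using x(1) by simp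
qed

lemma Q_arrE:
  assumes "X \<in> arr Q" obtains l where "l \<in> A" "r l \<in> H" "X = cls l"
  using assms unfolding arr_Q by blast

lemma cls_in_arr_Q: "\<lbrakk>l \<in> A; r l \<in> H\<rbrakk> \<Longrightarrow> cls l \<in> arr Q"
  unfolding arr_Q by blast

lemma Q_composable_iff:
  assumes "l \<in> A" "m \<in> A" shows "src Q (cls l) = rng Q (cls m) \<longleftrightarrow> s l = r m"
  using assms cls_obj_eq_iff[OF src_objs rng_objs] by (simp add: src_Q rng_Q)

lemma cls_in_objs_Q: "v \<in> H \<Longrightarrow> cls v \<in> objs Q"
  using H_Per_objs[of v] cls_in_arr_Q[of v]
  by (simp add: objs_def[of Q] rng_Q src_Q obj_arr obj_r obj_s)

lemma objs_QE:
  assumes "X \<in> objs Q" obtains v where "v \<in> H" "X = cls v"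
proof -
  obtain l where l: "l \<in> A" "r l \<in> H" "X = cls l" using assms Q_arrE unfolding objs_def by blast
  then have "X = cls (r l)" using assms rng_Q[OF l(1)] by (simp add: objs_def)
  then show thesis using that l(2) by blast
qed

text \<open>
  A representative of the class has degree \<open>n\<close> only modulo \<open>Per(\<Lambda>)\<close>; as its range lies in
  \<open>H\<^bsub>Per\<^esub>\<close>, it is equivalent to a path of degree exactly \<open>n\<close>.
\<close>

lemma class_representative_of_degree:
  assumes "X \<in> arr Q" "deg Q X = q n"
  obtains l where "l \<in> A" "r l \<in> H" "d l = n" "X = cls l"
proof -
  obtain l where l: "l \<in> A" "r l \<in> H" "X = cls l" using Q_arrE[OF assms(1)] .
  have "int_vec (d l) - int_vec n \<in> Per \<Lambda>" using assms(2) deg_Q[OF l(1)] l(3) q_Per_eq_iff by simp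
  then obtain \<mu> where \<mu>: "\<mu> \<in> A" "d \<mu> = n" "l \<sim> \<mu>" using H_Per_exchange l by blast
  moreover have "r \<mu> \<in> H" using l(2) equiv_r[OF \<mu>(3)] by simp
  moreover have "X = cls \<mu>" using cls_eq_iff l \<mu> by blast
  ultimately show thesis using that by blast
qed

lemma small_category_Q: "small_category Q"
proof
  show "rng Q f \<in> objs Q" "src Q f \<in> objs Q" "cmp Q (rng Q f) f = f" "cmp Q f (src Q f) = f"
    if f: "f \<in> arr Q" for f
  proof -
    obtain l where l: "l \<in> A" "r l \<in> H" "f = cls l" using Q_arrE[OF f] .
    show "rng Q f \<in> objs Q" "src Q f \<in> objs Q"
      using l cls_in_objs_Q H_Per_downstream by (simp_all add: rng_Q src_Q)
    show "cmp Q (rng Q f) f = f" "cmp Q f (src Q f) = f"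
      using l cmp_Q[of "r l" l] cmp_Q[of l "s l"] by (simp_all add: rng_Q src_Q)
  qed
next
  fix f g assume "f \<in> arr Q" "g \<in> arr Q" and comp: "src Q f = rng Q g"
  then obtain l m where l: "l \<in> A" "r l \<in> H" "f = cls l" and m: "m \<in> A" "r m \<in> H" "g = cls m"
    using Q_arrE by metis
  then have lm: "s l = r m" using comp Q_composable_iff by simp
  have c: "cmp Q f g = cls (l \<odot> m)" using cmp_Q l m lm by simp
  show "cmp Q f g \<in> arr Q" unfolding c using l m lm by (intro cls_in_arr_Q) auto
  show "rng Q (cmp Q f g) = rng Q f" "src Q (cmp Q f g) = src Q g"
    unfolding c using l m lm by (simp_all add: rng_Q src_Q)
  fix h assume "h \<in> arr Q" and comp': "src Q g = rng Q h"
  then obtain n where n: "n \<in> A" "r n \<in> H" "h = cls n" using Q_arrE by metis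
  then have mn: "s m = r n" using comp' m Q_composable_iff by simp
  show "cmp Q (cmp Q f g) h = cmp Q f (cmp Q g h)"
    unfolding c using l m n lm mn by (simp add: cmp_Q cmp_assoc)
qed

text \<open>
  Choose a representative of degree \<open>m + n\<close> and factor it in \<open>\<Lambda>\<close>. Any other factorisation has
  factors represented in the degrees \<open>m\<close> and \<open>n\<close>; their composite is equivalent to the chosen
  representative and of the same degree, hence equal to it, and unique factorisation in \<open>\<Lambda>\<close> applies.
\<close>

lemma factorisation_Q:
  assumes \<xi>: "\<xi> \<in> arr Q" "deg Q \<xi> = q m \<otimes>\<^bsub>M\<^esub> q n"
  shows "\<exists>!(\<eta>, \<zeta>). \<eta> \<in> arr Q \<and> \<zeta> \<in> arr Q \<and> src Q \<eta> = rng Q \<zeta>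
    \<and> deg Q \<eta> = q m \<and> deg Q \<zeta> = q n \<and> \<xi> = cmp Q \<eta> \<zeta>"
proof -
  obtain x where x: "x \<in> A" "r x \<in> H" "d x = m + n" "\<xi> = cls x"
    using class_representative_of_degree[OF \<xi>(1)] \<xi>(2) unfolding mult_M by blast
  obtain a b where ab: "a \<in> A" "b \<in> A" "s a = r b" "d a = m" "d b = n" "x = a \<odot> b"
    using factor_ex[OF x(1,3)] .
  have ra: "r a \<in> H" using x(2) ab by simp
  have rb: "r b \<in> H" using H_Per_downstream[OF ab(1) ra] ab(3) by simp
  show ?thesis
  proof (rule ex1_pairI)
    show "cls a \<in> arr Q \<and> cls b \<in> arr Q \<and> src Q (cls a) = rng Q (cls b)
        \<and> deg Q (cls a) = q m \<and> deg Q (cls b) = q n \<and> \<xi> = cmp Q (cls a) (cls b)"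
      using ab ra rb x(4) by (simp add: cls_in_arr_Q src_Q rng_Q deg_Q cmp_Q)
  next
    fix \<eta> \<zeta>
    assume as: "\<eta> \<in> arr Q \<and> \<zeta> \<in> arr Q \<and> src Q \<eta> = rng Q \<zeta>
        \<and> deg Q \<eta> = q m \<and> deg Q \<zeta> = q n \<and> \<xi> = cmp Q \<eta> \<zeta>"
    obtain e where e: "e \<in> A" "r e \<in> H" "d e = m" "\<eta> = cls e"
      using class_representative_of_degree as by blast
    obtain z where z: "z \<in> A" "r z \<in> H" "d z = n" "\<zeta> = cls z"
      using class_representative_of_degree as by blast
    have ez: "s e = r z" using as e z Q_composable_iff by simp
    have "cls x = cls (e \<odot> z)" using as x(4) e z ez cmp_Q by simp
    then have "x \<sim> e \<odot> z" using cls_eq_iff x(1) e z ez by simp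
    moreover have "d x = d (e \<odot> z)" using x(3) e z ez by simp
    ultimately have "a \<odot> b = e \<odot> z" using equiv_same_degree ab(6) by blast
    moreover have "d a = d e" using ab(4) e(3) by simp
    ultimately have "a = e" "b = z"
      using factor_unique ab(1-3) e(1) z(1) ez by metis+
    then show "\<eta> = cls a \<and> \<zeta> = cls b" using e z by simp
  qed
qed

lemma P_graph_Q: "P_graph M Q"
proof (intro P_graph.intro P_graph_axioms.intro)
  show "fg_cancellative_comm_monoid M" by (rule fg_cancellative_comm_monoid_M)
  show "small_category Q" by (rule small_category_Q)
  show "countable (arr Q)"
    unfolding arr_Q using countable_arr by (intro countable_image countable_subset[OF _ countable_arr]) auto
  show "deg Q \<xi> \<in> carrier M" if "\<xi> \<in> arr Q" for \<xi>
    using that by (auto elim!: Q_arrE simp: deg_Q carrier_M)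
  show "deg Q v = \<one>\<^bsub>M\<^esub>" if v: "v \<in> objs Q" for v
  proof -
    obtain w where "w \<in> H" "v = cls w" using objs_QE[OF v] .
    then show ?thesis using H_Per_objs[of w] by (simp add: deg_Q one_M obj_arr obj_d)
  qed
  show "deg Q (cmp Q \<eta> \<zeta>) = deg Q \<eta> \<otimes>\<^bsub>M\<^esub> deg Q \<zeta>"
    if Q: "\<eta> \<in> arr Q" "\<zeta> \<in> arr Q" "src Q \<eta> = rng Q \<zeta>" for \<eta> \<zeta>
  proof -
    obtain a b where a: "a \<in> A" "r a \<in> H" "\<eta> = cls a" and b: "b \<in> A" "r b \<in> H" "\<zeta> = cls b"
      using Q Q_arrE by metis
    have ab: "s a = r b" using Q(3) a b Q_composable_iff by simp
    then show ?thesis using a b by (simp add: cmp_Q deg_Q mult_M del: int_vec_add)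
  qed
  show "\<exists>!(\<eta>, \<zeta>). \<eta> \<in> arr Q \<and> \<zeta> \<in> arr Q \<and> src Q \<eta> = rng Q \<zeta>
      \<and> deg Q \<eta> = x \<and> deg Q \<zeta> = y \<and> \<xi> = cmp Q \<eta> \<zeta>"
    if "\<xi> \<in> arr Q" and xy: "x \<in> carrier M" "y \<in> carrier M" and "deg Q \<xi> = x \<otimes>\<^bsub>M\<^esub> y" for \<xi> x y
  proof -
    obtain m n where mn: "x = q m" "y = q n" using xy unfolding carrier_M by blast
    show ?thesis
      using factorisation_Q[OF that(1) that(4)[unfolded mn]] unfolding mn .
  qed
qed

section \<open>The pullback\<close>

abbreviation "PB \<equiv> pullback q Q"
abbreviation "cls_deg \<equiv> (\<lambda>l. (cls l, d l))"

lemma bij_betw_pullback: "bij_betw cls_deg (arr (restrict_range \<Lambda> H)) (arr PB)"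
proof (rule bij_betw_imageI)
  have arr_R: "arr (restrict_range \<Lambda> H) = {l \<in> A. r l \<in> H}" by (simp add: restrict_range_def)
  have arr_PB: "arr PB = {(\<xi>, n). \<xi> \<in> arr Q \<and> deg Q \<xi> = q n}" by (simp add: pullback_def)
  show "inj_on cls_deg (arr (restrict_range \<Lambda> H))"
    unfolding arr_R using cls_eq_iff equiv_same_degree by (intro inj_onI) auto
  show "cls_deg ` arr (restrict_range \<Lambda> H) = arr PB"
  proof (intro equalityI subsetI)
    fix y assume "y \<in> cls_deg ` arr (restrict_range \<Lambda> H)"
    then show "y \<in> arr PB" unfolding arr_R arr_PB using cls_in_arr_Q deg_Q by auto
  next
    fix y assume "y \<in> arr PB"
    then obtain \<xi> n where y: "y = (\<xi>, n)" "\<xi> \<in> arr Q" "deg Q \<xi> = q n" unfolding arr_PB by auto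
    obtain l where "l \<in> A" "r l \<in> H" "d l = n" "\<xi> = cls l"
      using class_representative_of_degree[OF y(2,3)] .
    then show "y \<in> cls_deg ` arr (restrict_range \<Lambda> H)" unfolding arr_R y(1) by blast
  qed
qed

lemma degree_functor_pullback: "degree_functor (restrict_range \<Lambda> H) PB cls_deg"
  unfolding degree_functor_def restrict_range_def pullback_def
  by (auto simp: rng_Q src_Q cmp_Q deg_Q cls_in_arr_Q simp del: int_vec_add)

lemma pullback_iso: "P_graph_iso plus_monoid (restrict_range \<Lambda> H) PB cls_deg"
  by (rule P_graph_transport(2)[OF P_graph_restrict_range[OF P_graph_axioms hereditary_H_Per]
        degree_functor_pullback bij_betw_pullback])

end

theorem theorem4p2:
  fixes \<Lambda> :: "('a, nat^'k::finite) pgraph"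
  assumes "k_graph \<Lambda>"
    and "row_finite_no_sources \<Lambda>"
    and "maximal_tail \<Lambda> (objs \<Lambda>)"
  shows "subgroup (Per \<Lambda>) plus_monoid
    \<and> (H_Per \<Lambda> \<noteq> {} \<and> hereditary \<Lambda> (H_Per \<Lambda>)
      \<and> (\<forall>p q. int_vec p - int_vec q \<in> Per \<Lambda> \<longrightarrow>
            (\<forall>x\<in>inf_paths_from \<Lambda> (H_Per \<Lambda>). shift p x = shift q x)))
    \<and> ((\<forall>l\<in>arr \<Lambda>. \<forall>m. rng \<Lambda> l \<in> H_Per \<Lambda> \<and> int_vec (deg \<Lambda> l) - int_vec m \<in> Per \<Lambda> \<longrightarrow>
            (\<exists>!\<mu>. \<mu> \<in> paths_of_degree \<Lambda> (rng \<Lambda> l) m \<and> (\<mu>, l) \<in> path_equiv \<Lambda>))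
      \<and> (\<forall>l \<mu>. (l, \<mu>) \<in> path_equiv \<Lambda> \<and> deg \<Lambda> l = deg \<Lambda> \<mu> \<longrightarrow> l = \<mu>))
    \<and> (P_graph (q_monoid \<Lambda>) (quotient_graph \<Lambda> (H_Per \<Lambda>))
      \<and> (\<forall>l\<in>arr \<Lambda>. rng \<Lambda> l \<in> H_Per \<Lambda> \<longrightarrow>
            deg (quotient_graph \<Lambda> (H_Per \<Lambda>)) (path_class \<Lambda> l) = q_Per \<Lambda> (int_vec (deg \<Lambda> l))))
    \<and> P_graph_iso plus_monoid (restrict_range \<Lambda> (H_Per \<Lambda>))
        (pullback (\<lambda>n. q_Per \<Lambda> (int_vec n)) (quotient_graph \<Lambda> (H_Per \<Lambda>)))
        (\<lambda>l. (path_class \<Lambda> l, deg \<Lambda> l))"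
proof -
  interpret maximal_tail_graph \<Lambda>
    using assms by (intro maximal_tail_graph.intro row_finite_higher_rank_graph.intro
        higher_rank_graph.intro row_finite_higher_rank_graph_axioms.intro
        maximal_tail_graph_axioms.intro)
  show ?thesis
  proof (intro conjI allI ballI impI)
    show "subgroup (Per \<Lambda>) plus_monoid" by (rule subgroup_Per)
    show "H \<noteq> {}" by (rule H_Per_nonempty)
    show "hereditary \<Lambda> H" by (rule hereditary_H_Per)
    show "shift p x = shift q x" if "int_vec p - int_vec q \<in> Per \<Lambda>" "x \<in> inf_paths_from \<Lambda> H" for p q x
      using that shift_eq_on_H_Per unfolding inf_paths_from_def by blast
    show "\<exists>!\<mu>. \<mu> \<in> paths_of_degree \<Lambda> (rng \<Lambda> l) m \<and> (\<mu>, l) \<in> path_equiv \<Lambda>"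
      if "l \<in> A" "r l \<in> H \<and> int_vec (d l) - int_vec m \<in> Per \<Lambda>" for l m
      using unique_equiv_of_degree that by blast
    show "l = \<mu>" if "l \<sim> \<mu> \<and> d l = d \<mu>" for l \<mu>
      using equiv_same_degree that by blast
    show "P_graph M Q" by (rule P_graph_Q)
    show "deg Q (cls l) = q_Per \<Lambda> (int_vec (d l))" if "l \<in> A" for l
      by (rule deg_Q[OF that])
    show "P_graph_iso plus_monoid (restrict_range \<Lambda> H) PB cls_deg" by (rule pullback_iso)
  qed
qed

end
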